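(* For all real $T\ge 2$, \[ \sum_{\substack{1\le n,m\le T\\ 2\nmid nm\\ nm\le T}} \Big(\frac{n}{m}\Big) = \frac{6\zeta(2)}{7\zeta(3)}\,T + O\big(T^{3/4}\log T\big), \] where $\zeta$ is the Riemann zeta function and the implied constant is absolute.
   Context: $\big(\frac{n}{m}\big)$ denotes the Jacobi symbol, defined for integers $n$ and odd positive integers $m$. The sum runs over pairs of odd positive integers $(n,m)$ with $nm\le T$. *)

theory Defs
  imports "HOL-Analysis.Analysis" "HOL-Number_Theory.Number_Theory"
begin

(* The Jacobi symbol (n/m); only meaningful for odd m > 0, where every prime factor p of m
   is odd, so that Legendre n p is the usual Legendre symbol (0 if p divides n). The product
   runs over prime factors with multiplicity; in particular jacobi n 1 = 1. *)
definition jacobi :: "int \<Rightarrow> int \<Rightarrow> int" where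
  "jacobi n m = (\<Prod>p\<in>#prime_factorization m. Legendre n p)"

(* The Riemann zeta function on real s > 1, by its Dirichlet series (shifted to start at
   index 0). It is not the analytic continuation for s \<le> 1. *)
definition zeta :: "real \<Rightarrow> real" where
  "zeta s = (\<Sum>k. 1 / real (Suc k) powr s)"

end

theory Submission
  imports Defs "HOL-Computational_Algebra.Squarefree"
begin

text \<open>
  By the hyperbola method and quadratic reciprocity, the sum becomes a sum over odd moduli
  $m \le \sqrt T$ of character sums in $n$ modulo $m$, twisted by a sign depending only on $n$ modulo 4.
  If $m$ is not a square, the character is nonprincipal and the Polya-Vinogradov inequality bounds each
  sum by $O(\sqrt m \log m)$, for a total of $O(T^{3/4} \log T)$. If $m = k^2$, the inner sums count
  odd integers coprime to $k$ and contribute $T \varphi(k) / k^3$ up to $O(\sqrt T)$; there are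
  at most $T^{1/4}$ such $k$, and $\sum_{k \text{ odd}} \varphi(k) / k^3 = 6 \zeta(2) / (7 \zeta(3))$.

  The Polya-Vinogradov inequality is proved by completion for squarefree $m$, where all Fourier
  coefficients have modulus at most $\sqrt m$ by the Chinese remainder theorem.
\<close>

section \<open>The Jacobi symbol\<close>

text \<open>Reciprocity is what keeps the moduli small: a pair whose second entry exceeds
  \<open>sqrt T\<close> has a small first entry, and exchanging the two makes the small entry the
  modulus. The price is the sign, hence sums over residue classes modulo 4. For odd \<open>m\<close>
  such a class is as good as an interval, since 4 is invertible modulo \<open>m\<close>. A square
  factor of the modulus is an obstacle to completion. If \<open>p\<close> is an odd prime and the
  modulus contains exactly p^2, that part contributes p(p - 1) instead of p at frequencies divisible
  by p^2, so the bound \<open>sqrt m\<close> for the coefficients fails. The factor p^2 is therefore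
  removed before completion, by subtracting the multiples of \<open>p\<close>, instead of passing to
  primitive characters. A third error, besides those of the nonsquare and the square moduli, comes
  from truncating the totient series at about T^(1/4); it is T / T^(1/4) and so again of order
  T^(3/4). The logarithm comes from completion alone.\<close>

lemma Legendre_cases: "Legendre a p = 0 \<or> Legendre a p = 1 \<or> Legendre a p = -1"
  by (simp add: Legendre_def)

lemma Legendre_eq_0_iff: "Legendre a p = 0 \<longleftrightarrow> p dvd a"
  by (auto simp: Legendre_def cong_0_iff)

lemma Legendre_cong: "[a = b] (mod p) \<Longrightarrow> Legendre a p = Legendre b p"
  by (simp add: Legendre_def QuadRes_def cong_def)

lemma odd_prime_gt_2: "prime (p::int) \<Longrightarrow> odd p \<Longrightarrow> 2 < p"
  using prime_ge_2_int[of p] by (cases "p = 2") auto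

text \<open>Euler's criterion gives the identity modulo \<open>p\<close>; both sides lie in
  \<open>{-1, 0, 1}\<close>, so they differ by at most 2, and \<open>2 < p\<close> forces
  equality.\<close>

lemma Legendre_mult:
  fixes p :: int
  assumes "prime p" "odd p"
  shows "Legendre (a * b) p = Legendre a p * Legendre b p"
proof -
  define q where "q = nat p"
  have p: "p = int q" and q: "prime q" "2 < q"
    using assms odd_prime_gt_2[OF assms] by (auto simp: q_def)
  note E = euler_criterion[OF q, folded p]
  have "[Legendre (a * b) p = Legendre a p * Legendre b p] (mod p)"
    using cong_trans[OF E[of "a * b"]] cong_mult[OF E[of a] E[of b]]
    by (metis cong_sym power_mult_distrib)
  then have d: "p dvd Legendre (a * b) p - Legendre a p * Legendre b p"
    by (simp add: cong_iff_dvd_diff)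
  have "\<bar>Legendre (a * b) p - Legendre a p * Legendre b p\<bar> < p"
    using Legendre_cases[of "a * b" p] Legendre_cases[of a p] Legendre_cases[of b p]
      odd_prime_gt_2[OF assms] by (elim disjE) simp_all
  with d have "Legendre (a * b) p - Legendre a p * Legendre b p = 0"
    using dvd_imp_le_int[OF _ d] by linarith
  then show ?thesis by simp
qed

text \<open>Splitting off one prime at a time matches the product in \<open>jacobi\<close>, so that
  properties of the Jacobi symbol reduce to those of the Legendre symbol.\<close>

lemma odd_pos_induct [consumes 2, case_names 1 prime_mult]:
  fixes m :: int
  assumes "odd m" "0 < m" "P 1"
    and "\<And>p m. prime p \<Longrightarrow> odd p \<Longrightarrow> odd m \<Longrightarrow> 0 < m \<Longrightarrow> P m \<Longrightarrow> P (p * m)"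
  shows "P m"
  using assms(1,2)
proof (induction "nat m" arbitrary: m rule: less_induct)
  case less
  show ?case
  proof (cases "m = 1")
    case False
    then have "\<not> is_unit m" using less.prems by auto
    then obtain p where p: "prime p" "p dvd m"
      using less.prems prime_divisor_exists[of m] by auto
    then obtain k where k: "m = p * k" by (elim dvdE)
    have "1 < p" using p(1) by (rule prime_gt_1_int)
    then have "0 < p" by simp
    then have "0 < k" using k less.prems by (simp add: zero_less_mult_iff)
    moreover have "k < m" unfolding k using \<open>0 < k\<close> \<open>1 < p\<close> by simp
    moreover have "odd p" "odd k" using k less.prems by auto
    ultimately show ?thesis
      using assms(4)[of p k] less.hyps[of k] less.prems k p by simp
  qed (use assms in simp)
qed

lemma jacobi_1 [simp]: "jacobi n 1 = 1"
  by (simp add: jacobi_def)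

lemma jacobi_prime: "prime p \<Longrightarrow> jacobi n p = Legendre n p"
  by (simp add: jacobi_def prime_factorization_prime)

lemma jacobi_mult_right:
  "m \<noteq> 0 \<Longrightarrow> k \<noteq> 0 \<Longrightarrow> jacobi n (m * k) = jacobi n m * jacobi n k"
  by (simp add: jacobi_def prime_factorization_mult)

lemma jacobi_prime_mult: "prime p \<Longrightarrow> 0 < m \<Longrightarrow> jacobi n (p * m) = Legendre n p * jacobi n m"
  by (subst jacobi_mult_right) (auto simp: jacobi_prime)

lemma jacobi_mult_left:
  assumes "odd m" "0 < m"
  shows "jacobi (a * b) m = jacobi a m * jacobi b m"
  using assms
  by (induction rule: odd_pos_induct) (simp_all add: jacobi_prime_mult Legendre_mult)

lemma jacobi_cong:
  assumes "odd m" "0 < m" "[a = b] (mod m)"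
  shows "jacobi a m = jacobi b m"
  using assms
proof (induction rule: odd_pos_induct)
  case (prime_mult p m)
  then have "[a = b] (mod p)" "[a = b] (mod m)"
    by (meson cong_dvd_modulus dvd_triv_left dvd_triv_right)+
  then show ?case using prime_mult Legendre_cong[of a b p] by (simp add: jacobi_prime_mult)
qed simp

lemma jacobi_abs_eq:
  assumes "odd m" "0 < m"
  shows "\<bar>jacobi n m\<bar> = (if coprime n m then 1 else 0)"
  using assms
proof (induction rule: odd_pos_induct)
  case (prime_mult p m)
  have "coprime n p \<longleftrightarrow> \<not> p dvd n"
    using prime_mult prime_imp_coprime[of p n] by (metis coprime_commute not_coprimeI not_prime_unit dvd_refl)
  then have "\<bar>Legendre n p\<bar> = (if coprime n p then 1 else 0)"
    using Legendre_cases[of n p] Legendre_eq_0_iff[of n p] by auto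
  then show ?case using prime_mult by (simp add: jacobi_prime_mult abs_mult)
qed simp

lemma jacobi_abs_le: "odd m \<Longrightarrow> 0 < m \<Longrightarrow> \<bar>jacobi n m\<bar> \<le> 1"
  by (simp add: jacobi_abs_eq)

text \<open>Symbol values are 0 or of absolute value 1, so a squared symbol only records
  coprimality. These moduli carry the main term.\<close>

lemma jacobi_square_right:
  assumes "odd k" "0 < k"
  shows "jacobi n (k ^ 2) = (if coprime n k then 1 else 0)"
proof -
  have "jacobi n (k ^ 2) = \<bar>jacobi n k\<bar> ^ 2"
    using assms by (simp add: power2_eq_square jacobi_mult_right flip: abs_mult)
  then show ?thesis using jacobi_abs_eq[OF assms, of n] by simp
qed

text \<open>For odd \<^term>\<open>n\<close> and \<^term>\<open>m\<close> this is the reciprocity sign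
  $(-1)^{\frac{n-1}{2}\frac{m-1}{2}}$.\<close>

definition rsign :: "int \<Rightarrow> int \<Rightarrow> int" where
  "rsign n m = (if n mod 4 = 3 \<and> m mod 4 = 3 then - 1 else 1)"

lemma odd_mod_4: "odd (n::int) \<Longrightarrow> n mod 4 = 1 \<or> n mod 4 = 3"
  by presburger

lemma mod_4_mult: "(a * b) mod 4 = (if a mod 4 = b mod 4 then 1 else 3)"
  if "odd a" "odd b" for a b :: int
  using odd_mod_4[OF that(1)] odd_mod_4[OF that(2)] mod_mult_eq[of a 4 b] by auto

lemma rsign_commute: "rsign a b = rsign b a"
  by (simp add: rsign_def)

text \<open>Multiplicativity of the sign is what carries reciprocity from primes to
  products.\<close>

lemma rsign_mult: "odd a \<Longrightarrow> odd b \<Longrightarrow> odd c \<Longrightarrow> rsign (a * b) c = rsign a c * rsign b c"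
  using odd_mod_4[of a] odd_mod_4[of b] by (auto simp: rsign_def mod_4_mult)

lemma Legendre_reciprocity:
  assumes "prime p" "odd p" "prime q" "odd q"
  shows "Legendre p q = rsign p q * Legendre q p"
proof (cases "p = q")
  case True
  then show ?thesis using assms by (simp add: Legendre_eq_0_iff[THEN iffD2])
next
  case False
  have gt: "2 < p" "2 < q" using assms odd_prime_gt_2 by auto
  have "prime (nat p)" "prime (nat q)" using assms by auto
  then have "Legendre p q * Legendre q p = (-1::int) ^ (nat ((p - 1) div 2 * ((q - 1) div 2)))"
    using Quadratic_Reciprocity_int gt False by blast
  also have "\<dots> = rsign p q"
  proof -
    have "even ((p - 1) div 2) \<longleftrightarrow> p mod 4 \<noteq> 3" if "odd p" for p :: int
      using that by presburger
    then show ?thesis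
      using assms gt by (auto simp: rsign_def minus_one_power_iff even_nat_iff pos_imp_zdiv_nonneg_iff)
  qed
  finally have "Legendre p q * Legendre q p = rsign p q" .
  \<comment> \<open>\<open>Legendre q p\<close> is its own inverse, so multiplying by it moves it to
    the other side.\<close>
  moreover have "Legendre q p * Legendre q p = 1"
    using Legendre_cases[of q p] Legendre_eq_0_iff[of q p] assms False
    by (auto simp: primes_dvd_imp_eq)
  ultimately show ?thesis
    by (metis mult.assoc mult.right_neutral)
qed

lemma jacobi_1_left: "odd m \<Longrightarrow> 0 < m \<Longrightarrow> jacobi 1 m = 1"
  by (metis jacobi_abs_eq jacobi_mult_left mult_1 coprime_1_left abs_mult_self_eq)

text \<open>Two inductions over primes: the inner fact treats a prime modulus and builds up
  \<open>n\<close>, the outer one then builds up \<open>m\<close>. Common factors are absorbed at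
  the level of primes, where both symbols vanish if the primes coincide.\<close>

lemma jacobi_reciprocity:
  assumes n: "odd n" "0 < n" and m: "odd m" "0 < m"
  shows "jacobi n m = rsign n m * jacobi m n"
proof -
  have 1: "Legendre n p = rsign n p * jacobi p n" if p: "prime p" "odd p" for p
    using n
  proof (induction rule: odd_pos_induct)
    case 1
    have "Legendre 1 p = 1" using jacobi_1_left[of p] p jacobi_prime[of p 1] prime_gt_0_int by simp
    then show ?case by (simp add: rsign_def)
  next
    case (prime_mult q k)
    then show ?case using p
      by (simp add: Legendre_mult jacobi_prime_mult rsign_mult Legendre_reciprocity[of q p])
  qed
  show ?thesis
    using m
  proof (induction rule: odd_pos_induct)
    case 1
    then show ?case using jacobi_1_left n by (simp add: rsign_def)
  next
    case (prime_mult p m)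
    then show ?case using n 1[of p]
      by (simp add: jacobi_prime_mult jacobi_mult_left rsign_mult rsign_commute[of n])
  qed
qed

section \<open>Fourier analysis modulo q\<close>

text \<open>The additive character e(t/q) modulo \<open>q\<close>.\<close>

definition unity :: "int \<Rightarrow> int \<Rightarrow> complex" where
  "unity q t = cis (2 * pi * (of_int t / of_int q))"

lemma unity_0 [simp]: "unity q 0 = 1"
  by (simp add: unity_def)

lemma unity_add: "unity q (s + t) = unity q s * unity q t"
  by (simp add: unity_def cis_mult add_divide_distrib distrib_left)

lemma norm_unity [simp]: "norm (unity q t) = 1"
  by (simp add: unity_def)

lemma unity_mult_cancel: "p \<noteq> 0 \<Longrightarrow> unity (p * q) (p * t) = unity q t"
  by (simp add: unity_def)

lemma unity_multiple: "q \<noteq> 0 \<Longrightarrow> unity q (q * t) = 1"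
  using unity_mult_cancel[of q 1 t] by (simp add: unity_def)

lemma unity_cong: "q \<noteq> 0 \<Longrightarrow> [s = t] (mod q) \<Longrightarrow> unity q s = unity q t"
  by (metis cong_iff_lin unity_add unity_multiple mult.right_neutral)

text \<open>A weak form of Jordan's inequality. Up to \<open>pi / 3\<close> the mean value theorem
  applies with \<open>cos\<close> at least 1/2; beyond, \<open>sin x\<close> is at least
  \<open>sqrt 3 / 2\<close>, hence at least 17/20, which exceeds \<open>pi / 4\<close>.\<close>

lemma sin_ge_half:
  assumes "0 \<le> x" "x \<le> pi / 2"
  shows "x / 2 \<le> sin x"
proof (cases "x \<le> pi / 3")
  case True
  show ?thesis
  proof (cases "x = 0")
    case False
    then have "0 < x" using assms by simp
    then obtain z where z: "0 < z" "z < x" "sin x - sin 0 = (x - 0) * cos z"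
      using MVT2[of 0 x sin cos] DERIV_sin by blast
    have "cos (pi / 3) \<le> cos z" using z True by (intro cos_monotone_0_pi_le) auto
    then have "1 / 2 \<le> cos z" by (simp add: cos_60)
    then show ?thesis using z \<open>0 < x\<close> mult_left_mono[of "1/2" "cos z" x] by simp
  qed simp
next
  case False
  have "sin (pi / 3) \<le> sin x" using False assms by (intro sin_monotone_2pi_le) auto
  moreover have "(17/10 :: real) \<le> sqrt 3" by (rule real_le_rsqrt) (simp add: power2_eq_square)
  ultimately have "17 / 20 \<le> sin x" by (simp add: sin_60)
  then show ?thesis using assms pi_less_4 pi_approx by auto
qed

text \<open>With t = k/q the norm is 2 |sin(pi t)|, and the bound 2t(1 - t) is symmetric under t ->
  1 - t. Its reciprocal splits by partial fractions into multiples of 1/k and 1/(q - k), which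
  avoids the distance to the nearest integer.\<close>

lemma norm_unity_diff_1_ge:
  assumes "0 < k" "k < q"
  shows "2 * of_int k * of_int (q - k) / (of_int q)\<^sup>2 \<le> norm (unity q k - 1)"
proof -
  define t :: real where "t = of_int k / of_int q"
  have t: "0 < t" "t < 1" using assms by (auto simp: t_def)
  have "t * (1 - t) \<le> sin (pi * t)"
  proof (cases "t \<le> 1 / 2")
    case True
    have "t * (1 - t) \<le> t" using t by (simp add: mult_left_le)
    also have "\<dots> \<le> pi * t / 2" using t pi_ge_two by simp
    also have "\<dots> \<le> sin (pi * t)" using t True by (intro sin_ge_half) auto
    finally show ?thesis .
  next
    case False
    have "t * (1 - t) \<le> 1 - t" using t by (simp add: mult_left_le_one_le)
    also have "\<dots> \<le> pi * (1 - t) / 2" using t pi_ge_two mult_right_mono[of 2 pi "1 - t"] by simp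
    also have "\<dots> \<le> sin (pi * (1 - t))" using t False by (intro sin_ge_half) auto
    also have "\<dots> = sin (pi * t)" by (simp add: right_diff_distrib sin_diff)
    finally show ?thesis .
  qed
  moreover have "norm (unity q k - 1) = 2 * \<bar>sin (pi * t)\<bar>"
    using dist_exp_i_1[of "2 * pi * t"] by (simp add: unity_def t_def cis_conv_exp)
  moreover have "2 * of_int k * of_int (q - k) / (of_int q)\<^sup>2 = 2 * (t * (1 - t))"
    using assms by (simp add: t_def power2_eq_square field_simps)
  ultimately show ?thesis by linarith
qed

lemma unity_ne_1:
  assumes "0 < q" "\<not> q dvd t"
  shows "unity q t \<noteq> 1"
proof -
  have "0 < t mod q" "t mod q < q"
    using assms by (simp_all add: order_le_neq_trans dvd_eq_mod_eq_0)
  then have "0 < 2 * of_int (t mod q) * of_int (q - t mod q) / (of_int q :: real)\<^sup>2"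
    using assms by simp
  then have "unity q (t mod q) \<noteq> 1"
    using norm_unity_diff_1_ge[OF \<open>0 < t mod q\<close> \<open>t mod q < q\<close>] by (metis leD norm_zero right_minus_eq)
  then show ?thesis using unity_cong[of q t "t mod q"] assms by (simp add: cong_def)
qed

text \<open>Shifts are used for the orthogonality of additive characters, dilations for the Gauss
  sum identities.\<close>

lemma bij_betw_affine_mod:
  fixes q u c :: int
  assumes "0 < q" "coprime u q"
  shows "bij_betw (\<lambda>x. (u * x + c) mod q) {0..<q} {0..<q}"
proof -
  have "inj_on (\<lambda>x. (u * x + c) mod q) {0..<q}"
  proof (rule inj_onI)
    fix x y assume xy: "x \<in> {0..<q}" "y \<in> {0..<q}" "(u * x + c) mod q = (u * y + c) mod q"
    then have "[u * x + c = u * y + c] (mod q)" by (simp add: cong_def)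
    then have "[u * x = u * y] (mod q)" by (simp add: cong_add_rcancel)
    then have "[x = y] (mod q)" using assms cong_mult_lcancel by blast
    then show "x = y" using xy by (simp add: cong_def)
  qed
  moreover have "(\<lambda>x. (u * x + c) mod q) ` {0..<q} \<subseteq> {0..<q}" using assms by auto
  ultimately show ?thesis by (simp add: bij_betw_def endo_inj_surj)
qed

lemma sum_residues_affine:
  fixes f :: "int \<Rightarrow> 'a::comm_monoid_add"
  assumes "0 < q" "coprime u q" "\<And>x. f (x mod q) = f x"
  shows "(\<Sum>x\<in>{0..<q}. f (u * x + c)) = (\<Sum>x\<in>{0..<q}. f x)"
  using sum.reindex_bij_betw[OF bij_betw_affine_mod[OF assms(1,2), of c], of f] assms(3) by simp

lemma sum_unity:
  assumes "0 < q"
  shows "(\<Sum>k\<in>{0..<q}. unity q (k * t)) = (if q dvd t then of_int q else 0)"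
proof (cases "q dvd t")
  case True
  then have "unity q (k * t) = 1" for k
    using unity_multiple[of q] assms by (metis dvdE mult.left_commute order_less_irrefl)
  then show ?thesis using True assms by simp
next
  case False
  let ?S = "\<Sum>k\<in>{0..<q}. unity q (k * t)"
  have per: "unity q (x mod q * t) = unity q (x * t)" for x
    using assms by (intro unity_cong cong_scalar_right) (auto simp: cong_def)
  \<comment> \<open>Shifting \<open>k\<close> by 1 permutes the residues but multiplies the sum by
    \<open>unity q t\<close>, which is not 1.\<close>
  have "?S * unity q t = (\<Sum>k\<in>{0..<q}. unity q ((1 * k + 1) * t))"
    by (simp add: sum_distrib_right distrib_right unity_add)
  also have "\<dots> = ?S" by (rule sum_residues_affine) (use assms per in auto)
  finally show ?thesis using unity_ne_1[OF assms False] False by simp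
qed

text \<open>Unnormalised finite Fourier transform, so inversion carries a factor \<open>q\<close>.
  For a Jacobi symbol modulo \<open>q\<close> the values are Gauss sums.\<close>

definition fourier :: "int \<Rightarrow> (int \<Rightarrow> complex) \<Rightarrow> int \<Rightarrow> complex" where
  "fourier q f k = (\<Sum>n\<in>{0..<q}. f n * unity q (k * n))"

lemma fourier_inversion:
  assumes "0 < q" "\<And>x. f (x mod q) = f x"
  shows "(\<Sum>k\<in>{0..<q}. fourier q f k * unity q (- (k * j))) = of_int q * f j"
proof -
  have "(\<Sum>k\<in>{0..<q}. fourier q f k * unity q (- (k * j)))
      = (\<Sum>k\<in>{0..<q}. \<Sum>n\<in>{0..<q}. f n * unity q (k * (n - j)))"
    unfolding fourier_def sum_distrib_right
    by (intro sum.cong refl) (simp add: mult.assoc right_diff_distrib flip: unity_add)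
  also have "\<dots> = (\<Sum>n\<in>{0..<q}. f n * (\<Sum>k\<in>{0..<q}. unity q (k * (n - j))))"
    by (subst sum.swap) (simp add: sum_distrib_left)
  also have "\<dots> = (\<Sum>n\<in>{0..<q}. if n = j mod q then f n * of_int q else 0)"
  proof (intro sum.cong refl)
    fix n assume "n \<in> {0..<q}"
    then have "q dvd n - j \<longleftrightarrow> n = j mod q" by (simp add: mod_eq_dvd_iff[symmetric])
    then show "f n * (\<Sum>k\<in>{0..<q}. unity q (k * (n - j))) = (if n = j mod q then f n * of_int q else 0)"
      using assms(1) by (simp add: sum_unity)
  qed
  also have "\<dots> = of_int q * f j" using assms by (simp add: mult.commute)
  finally show ?thesis .
qed

text \<open>Multiplication by \<open>unity q k - 1\<close> telescopes the sum to two terms of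
  modulus 1; the lower bound for that factor is then divided out.\<close>

lemma norm_geometric_unity_le:
  assumes "0 < k" "k < q"
  shows "norm (\<Sum>n\<in>{x<..y}. unity q (- (k * n))) \<le> of_int q * (1 / of_int k + 1 / of_int (q - k))"
proof (cases "x \<le> y")
  case True
  let ?S = "\<Sum>n\<in>{x<..y}. unity q (- (k * n))"
  have "?S * (unity q k - 1) = unity q (- (k * x)) - unity q (- (k * y))"
    using True
  proof (induction y rule: int_ge_induct)
    case (step y)
    have "{x<..y + 1} = insert (y + 1) {x<..y}" using step by auto
    then have "(\<Sum>n\<in>{x<..y + 1}. unity q (- (k * n))) * (unity q k - 1)
      = unity q (- (k * (y + 1))) * (unity q k - 1) + (unity q (- (k * x)) - unity q (- (k * y)))"
      using step.IH by (simp add: distrib_right)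
    also have "unity q (- (k * (y + 1))) * unity q k = unity q (- (k * y))"
      by (simp add: algebra_simps flip: unity_add)
    then have "unity q (- (k * (y + 1))) * (unity q k - 1) + (unity q (- (k * x)) - unity q (- (k * y)))
      = unity q (- (k * x)) - unity q (- (k * (y + 1)))" by (simp add: right_diff_distrib)
    finally show ?case .
  qed simp
  then have "norm ?S * norm (unity q k - 1) \<le> 2"
    using norm_triangle_ineq4[of "unity q (- (k * x))" "unity q (- (k * y))"]
    by (simp flip: norm_mult)
  moreover have "norm ?S * (2 * of_int k * of_int (q - k) / (of_int q)\<^sup>2) \<le> norm ?S * norm (unity q k - 1)"
    using norm_unity_diff_1_ge[OF assms] by (intro mult_left_mono) auto
  ultimately have *: "norm ?S * (2 * of_int k * of_int (q - k) / (of_int q)\<^sup>2) \<le> 2" by linarith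
  define K Q :: real where "K = of_int k" and "Q = of_int q"
  have KQ: "0 < K" "K < Q" using assms by (auto simp: K_def Q_def)
  then have "0 < K * (Q - K)" by simp
  have "norm ?S * (2 * K * (Q - K) / Q\<^sup>2) \<le> 2" using * by (simp add: K_def Q_def)
  then have "norm ?S \<le> Q\<^sup>2 / (K * (Q - K))"
    using KQ \<open>0 < K * (Q - K)\<close> by (simp add: field_simps)
  also have "\<dots> = Q * (1 / K + 1 / (Q - K))"
    using KQ by (simp add: field_simps power2_eq_square)
  finally show ?thesis by (simp add: K_def Q_def)
next
  case False
  then show ?thesis using assms by simp
qed

text \<open>\<open>harm n - ln n\<close> is decreasing and equals 1 at \<open>n = 1\<close>.\<close>

lemma harm_le_1_plus_ln: "0 < n \<Longrightarrow> harm n \<le> 1 + ln (real n)"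
  using decseqD[OF decseq_harm_diff_ln, of 0 "n - 1"] by (simp add: harm_def)

lemma sum_inverse_le_ln:
  assumes "1 < q"
  shows "(\<Sum>k\<in>{1..<q}. 1 / real_of_int k) \<le> 1 + ln (of_int q)"
proof -
  have "(\<Sum>k\<in>{1..<q}. 1 / real_of_int k) = (\<Sum>k\<in>{1..nat (q - 1)}. 1 / real k)"
    by (rule sum.reindex_bij_witness[of _ int nat]) auto
  also have "\<dots> = harm (nat (q - 1))" by (simp add: harm_def divide_inverse)
  also have "\<dots> \<le> 1 + ln (real (nat (q - 1)))" using assms by (intro harm_le_1_plus_ln) auto
  also have "\<dots> \<le> 1 + ln (of_int q)" using assms by simp
  finally show ?thesis .
qed

text \<open>Fourier inversion replaces \<open>f\<close> by additive characters, whose sums over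
  intervals are geometric. Frequency 0 would contribute the length of the interval, hence the
  hypothesis on \<open>fourier q f 0\<close>. The reflection k -> q - k identifies the two harmonic
  sums, which gives the factor 2.\<close>

lemma completion_bound:
  fixes f :: "int \<Rightarrow> complex"
  assumes "1 < q" "\<And>x. f (x mod q) = f x" "fourier q f 0 = 0" "\<And>k. norm (fourier q f k) \<le> B"
  shows "norm (\<Sum>n\<in>{x<..y}. f n) \<le> 2 * B * (1 + ln (of_int q))"
proof -
  have B: "0 \<le> B" using assms(4)[of 0] norm_ge_zero order_trans by blast
  have "of_int q * (\<Sum>n\<in>{x<..y}. f n)
      = (\<Sum>n\<in>{x<..y}. \<Sum>k\<in>{0..<q}. fourier q f k * unity q (- (k * n)))"
    using assms by (simp add: sum_distrib_left fourier_inversion)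
  also have "\<dots> = (\<Sum>k\<in>{0..<q}. fourier q f k * (\<Sum>n\<in>{x<..y}. unity q (- (k * n))))"
    by (subst sum.swap) (simp add: sum_distrib_left)
  also have "\<dots> = (\<Sum>k\<in>{1..<q}. fourier q f k * (\<Sum>n\<in>{x<..y}. unity q (- (k * n))))"
    using assms by (intro sum.mono_neutral_right) (auto simp: order_le_less)
  finally have "of_int q * norm (\<Sum>n\<in>{x<..y}. f n)
      = norm (\<Sum>k\<in>{1..<q}. fourier q f k * (\<Sum>n\<in>{x<..y}. unity q (- (k * n))))"
    using assms(1) by (metis norm_mult norm_of_int abs_of_pos of_int_0_less_iff less_trans zero_less_one)
  also have "\<dots> \<le> (\<Sum>k\<in>{1..<q}. B * (of_int q * (1 / of_int k + 1 / of_int (q - k))))"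
    using assms(4) B norm_geometric_unity_le
    by (intro sum_norm_le) (auto simp: norm_mult intro!: mult_mono)
  also have "\<dots> = of_int q * (B * ((\<Sum>k\<in>{1..<q}. 1 / of_int k) + (\<Sum>k\<in>{1..<q}. 1 / of_int (q - k))))"
    by (simp add: sum_distrib_left sum.distrib algebra_simps)
  also have "(\<Sum>k\<in>{1..<q}. 1 / of_int (q - k)) = (\<Sum>k\<in>{1..<q}. 1 / real_of_int k)"
    by (rule sum.reindex_bij_witness[of _ "\<lambda>k. q - k" "\<lambda>k. q - k"]) auto
  finally have "norm (\<Sum>n\<in>{x<..y}. f n)
      \<le> B * ((\<Sum>k\<in>{1..<q}. 1 / real_of_int k) + (\<Sum>k\<in>{1..<q}. 1 / of_int k))"
    using assms(1) by (subst (asm) mult_le_cancel_left_pos) auto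
  also have "\<dots> \<le> B * (2 * (1 + ln (of_int q)))"
    using sum_inverse_le_ln[OF assms(1)] B by (intro mult_left_mono) auto
  finally show ?thesis by (simp add: mult_ac)
qed

section \<open>Gauss sums and incomplete character sums\<close>

text \<open>The modulus comes first so that \<open>jac m\<close> is a function to which
  \<open>fourier\<close> applies.\<close>

abbreviation jac :: "int \<Rightarrow> int \<Rightarrow> complex" where
  "jac m n \<equiv> of_int (jacobi n m)"

lemma jacobi_mod: "odd m \<Longrightarrow> 0 < m \<Longrightarrow> jacobi (x mod m) m = jacobi x m"
  by (rule jacobi_cong) (auto simp: cong_def)

lemma norm_jac_le_1: "odd m \<Longrightarrow> 0 < m \<Longrightarrow> norm (jac m n) \<le> 1"
  using jacobi_abs_le[of m n] by (metis norm_of_int of_int_abs of_int_le_1_iff)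

text \<open>Without a nonresidue, squaring would map the residues onto themselves and so be
  injective, but 1 and \<open>p - 1\<close> have the same square.\<close>

lemma ex_Legendre_eq_minus_1:
  assumes "prime p" "odd p"
  shows "\<exists>u. Legendre u p = - 1"
proof (rule ccontr)
  assume *: "\<nexists>u. Legendre u p = - 1"
  have p: "2 < p" by (rule odd_prime_gt_2[OF assms])
  have surj: "{0..<p} \<subseteq> (\<lambda>x. x\<^sup>2 mod p) ` {0..<p}"
  proof
    fix a assume a: "a \<in> {0..<p}"
    have "QuadRes p a"
    proof (cases "p dvd a")
      case True
      then have "[0\<^sup>2 = a] (mod p)" by (simp add: cong_def mod_eq_0_iff_dvd)
      then show ?thesis unfolding QuadRes_def by blast
    next
      case False
      then show ?thesis using * by (auto simp: Legendre_def cong_0_iff split: if_splits)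
    qed
    then obtain y where "[y\<^sup>2 = a] (mod p)" by (auto simp: QuadRes_def)
    then have "(y mod p)\<^sup>2 mod p = a" using a by (simp add: cong_def power_mod)
    then show "a \<in> (\<lambda>x. x\<^sup>2 mod p) ` {0..<p}" using p
      by (intro image_eqI[of _ _ "y mod p"]) auto
  qed
  have "inj_on (\<lambda>x. x\<^sup>2 mod p) {0..<p}"
    using surj by (intro finite_surj_inj) auto
  moreover have "1\<^sup>2 mod p = (p - 1)\<^sup>2 mod p"
    by (simp add: mod_eq_dvd_iff power2_eq_square algebra_simps)
  ultimately show False using p by (auto dest: inj_onD[of _ _ 1 "p - 1"])
qed

text \<open>Multiplying the argument by a nonresidue permutes the residues and changes the sign of
  the sum.\<close>

lemma fourier_jacobi_prime_0:
  assumes "prime p" "odd p"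
  shows "fourier p (jac p) 0 = 0"
proof -
  obtain u where u: "Legendre u p = - 1" using ex_Legendre_eq_minus_1[OF assms] by blast
  have p: "0 < p" using prime_gt_0_int[OF assms(1)] .
  have "coprime u p"
    using u jacobi_abs_eq[of p u] assms p by (auto simp: jacobi_prime split: if_splits)
  have "(\<Sum>x\<in>{0..<p}. jac p x) = (\<Sum>x\<in>{0..<p}. jac p (u * x + 0))"
    using p \<open>coprime u p\<close> assms by (intro sum_residues_affine[symmetric]) (auto simp: jacobi_mod)
  also have "\<dots> = - (\<Sum>x\<in>{0..<p}. jac p x)"
    using assms p u jacobi_prime[of p u] by (simp add: jacobi_mult_left sum_negf)
  finally show ?thesis by (simp add: fourier_def)
qed

text \<open>Substituting \<open>k * n\<close> for \<open>n\<close> pulls the frequency out as a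
  symbol. If \<open>p dvd k\<close> this substitution is not invertible, but then both sides vanish:
  the symbol at \<open>k\<close>, and the transform, which is the one at frequency 0.\<close>

lemma fourier_jacobi_prime:
  assumes "prime p" "odd p"
  shows "fourier p (jac p) k = jac p k * fourier p (jac p) 1"
proof -
  have p: "0 < p" using prime_gt_0_int[OF assms(1)] .
  show ?thesis
  proof (cases "p dvd k")
    case True
    then obtain j where "k = p * j" by blast
    then have "fourier p (jac p) k = fourier p (jac p) 0"
      using p by (simp add: fourier_def unity_multiple mult.assoc)
    moreover have "jac p k = 0"
      using True assms(1) by (simp add: jacobi_prime Legendre_eq_0_iff)
    ultimately show ?thesis using fourier_jacobi_prime_0[OF assms] by simp
  next
    case False
    then have "coprime k p" using assms(1) prime_imp_coprime coprime_commute by blast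
    then have "\<bar>jacobi k p\<bar> = 1" using jacobi_abs_eq[of p k] assms p by simp
    then have sq: "jacobi k p * jacobi k p = 1" by (metis abs_mult_self_eq mult_1)
    have per: "jac p (x mod p) * unity p (x mod p) = jac p x * unity p x" for x
      using assms p unity_cong[of p x "x mod p"] by (simp add: jacobi_mod cong_def)
    have "jac p k * fourier p (jac p) 1 = jac p k * (\<Sum>n\<in>{0..<p}. jac p (k * n + 0) * unity p (k * n + 0))"
      unfolding fourier_def using p \<open>coprime k p\<close> per by (subst sum_residues_affine) auto
    also have "\<dots> = (\<Sum>n\<in>{0..<p}. (jac p k * jac p k) * (jac p n * unity p (k * n)))"
      using assms p by (simp add: jacobi_mult_left sum_distrib_left mult_ac)
    also have "\<dots> = fourier p (jac p) k"
      unfolding fourier_def of_int_mult[symmetric] sq by simp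
    finally show ?thesis by simp
  qed
qed

text \<open>Fourier inversion at the point 1 gives $p = \pm g^2$ for the Gauss sum $g$ at frequency 1.\<close>

lemma norm_fourier_jacobi_prime_le:
  assumes "prime p" "odd p"
  shows "norm (fourier p (jac p) k) \<le> sqrt (of_int p)"
proof -
  let ?g = "fourier p (jac p)"
  have p: "0 < p" using prime_gt_0_int[OF assms(1)] .
  have "of_int p = (\<Sum>k\<in>{0..<p}. ?g k * unity p (- (k * 1)))"
    using fourier_inversion[of p "jac p" 1] assms p by (simp add: jacobi_mod jacobi_1_left)
  also have "\<dots> = ?g 1 * (\<Sum>k\<in>{0..<p}. jac p k * unity p (- 1 * k))"
    unfolding sum_distrib_left
    by (intro sum.cong refl) (subst fourier_jacobi_prime[OF assms], simp add: mult_ac)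
  also have "(\<Sum>k\<in>{0..<p}. jac p k * unity p (- 1 * k)) = ?g (- 1)" by (simp only: fourier_def)
  also have "\<dots> = jac p (- 1) * ?g 1" by (rule fourier_jacobi_prime[OF assms])
  finally have "norm (of_int p :: complex) = norm (?g 1 * (jac p (- 1) * ?g 1))" by simp
  moreover have "\<bar>jacobi (- 1) p\<bar> = 1" using assms p by (simp add: jacobi_abs_eq)
  then have "norm (jac p (- 1)) = 1" by (metis norm_of_int of_int_abs of_int_1)
  ultimately have "(norm (?g 1))\<^sup>2 = of_int p"
    using p by (simp add: norm_mult power2_eq_square)
  then have g1: "norm (?g 1) = sqrt (of_int p)" by (metis norm_ge_zero real_sqrt_unique)
  have "norm (?g k) = norm (jac p k) * norm (?g 1)"
    by (subst fourier_jacobi_prime[OF assms]) (simp add: norm_mult)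
  also have "\<dots> \<le> 1 * norm (?g 1)" using assms p by (intro mult_right_mono norm_jac_le_1) auto
  finally show ?thesis using g1 by simp
qed

text \<open>The Chinese remainder map is written as \<open>m * x + p * y\<close> because this form
  splits the additive character modulo \<open>p * m\<close> into one modulo \<open>p\<close> and one
  modulo \<open>m\<close>. Surjectivity follows from injectivity by counting.\<close>

lemma bij_betw_CRT:
  fixes p m :: int
  assumes "0 < p" "0 < m" "coprime p m"
  shows "bij_betw (\<lambda>(x, y). (m * x + p * y) mod (p * m)) ({0..<p} \<times> {0..<m}) {0..<p * m}"
proof -
  let ?h = "\<lambda>(x, y). (m * x + p * y) mod (p * m)"
  have "inj_on ?h ({0..<p} \<times> {0..<m})"
  proof (rule inj_onI, clarify)
    fix x y x' y'
    assume xy: "x \<in> {0..<p}" "y \<in> {0..<m}" "x' \<in> {0..<p}" "y' \<in> {0..<m}"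
      and "(m * x + p * y) mod (p * m) = (m * x' + p * y') mod (p * m)"
    then have "[m * x + p * y = m * x' + p * y'] (mod p * m)" by (simp add: cong_def)
    then have "p * m dvd m * (x - x') + p * (y - y')"
      by (simp add: cong_iff_dvd_diff algebra_simps)
    then have "p dvd m * (x - x') + p * (y - y')" "m dvd m * (x - x') + p * (y - y')"
      using dvd_mult_left dvd_mult_right by blast+
    then have "p dvd m * (x - x')" "m dvd p * (y - y')"
      by (simp_all add: dvd_add_left_iff dvd_add_right_iff)
    then have "p dvd x - x'" "m dvd y - y'"
      using assms(3) by (simp_all add: coprime_dvd_mult_right_iff coprime_commute)
    then have "[x = x'] (mod p)" "[y = y'] (mod m)" by (simp_all add: cong_iff_dvd_diff)
    then show "x = x' \<and> y = y'" using xy by (simp add: cong_def)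
  qed
  moreover have "?h ` ({0..<p} \<times> {0..<m}) = {0..<p * m}"
  proof (rule card_subset_eq)
    show "?h ` ({0..<p} \<times> {0..<m}) \<subseteq> {0..<p * m}" using assms by auto
    show "card (?h ` ({0..<p} \<times> {0..<m})) = card {0..<p * m}"
      using assms calculation by (simp add: card_image card_cartesian_product nat_mult_distrib)
  qed simp
  ultimately show ?thesis by (simp add: bij_betw_def)
qed

lemma sum_CRT:
  fixes f :: "int \<Rightarrow> 'a::comm_monoid_add"
  assumes "0 < p" "0 < m" "coprime p m" "\<And>x. f (x mod (p * m)) = f x"
  shows "(\<Sum>n\<in>{0..<p * m}. f n) = (\<Sum>x\<in>{0..<p}. \<Sum>y\<in>{0..<m}. f (m * x + p * y))"
  using sum.reindex_bij_betw[OF bij_betw_CRT[OF assms(1-3)], of f] assms(4)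
  by (simp add: sum.cartesian_product case_prod_unfold)

text \<open>At \<open>m * x + p * y\<close> the symbol modulo \<open>p\<close> sees only
  \<open>m * x\<close>, and the one modulo \<open>m\<close> only \<open>p * y\<close>. The constant
  factor \<open>jac p m * jac m p\<close> has modulus at most 1, which suffices for upper
  bounds.\<close>

lemma fourier_jacobi_mult:
  assumes "odd p" "0 < p" "odd m" "0 < m" "coprime p m"
  shows "fourier (p * m) (jac (p * m)) k
    = jac p m * jac m p * fourier p (jac p) k * fourier m (jac m) k"
proof -
  have "unity (p * m) (k * (x mod (p * m))) = unity (p * m) (k * x)" for x
    using assms by (intro unity_cong cong_scalar_left) (auto simp: cong_def)
  then have "fourier (p * m) (jac (p * m)) k
      = (\<Sum>x\<in>{0..<p}. \<Sum>y\<in>{0..<m}. jac (p * m) (m * x + p * y) * unity (p * m) (k * (m * x + p * y)))"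
    unfolding fourier_def using assms by (intro sum_CRT) (auto simp: jacobi_mod)
  also have "\<dots> = (\<Sum>x\<in>{0..<p}. \<Sum>y\<in>{0..<m}.
      jac p m * jac m p * (jac p x * unity p (k * x)) * (jac m y * unity m (k * y)))"
  proof (intro sum.cong refl)
    fix x y
    have "jacobi (m * x + p * y) (p * m) = jacobi (m * x + p * y) p * jacobi (m * x + p * y) m"
      using assms by (simp add: jacobi_mult_right)
    also have "jacobi (m * x + p * y) p = jacobi (m * x) p"
      using assms by (intro jacobi_cong) (auto simp: cong_def)
    also have "jacobi (m * x + p * y) m = jacobi (p * y) m"
      using assms by (intro jacobi_cong) (auto simp: cong_def)
    finally have 1: "jacobi (m * x + p * y) (p * m) = jacobi m p * jacobi x p * (jacobi p m * jacobi y m)"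
      using assms by (simp add: jacobi_mult_left)
    have "unity (p * m) (k * (m * x + p * y)) = unity (m * p) (m * (k * x)) * unity (p * m) (p * (k * y))"
      by (simp add: algebra_simps flip: unity_add)
    also have "\<dots> = unity p (k * x) * unity m (k * y)"
      using assms unity_mult_cancel[of m p] unity_mult_cancel[of p m] by simp
    finally show "jac (p * m) (m * x + p * y) * unity (p * m) (k * (m * x + p * y))
      = jac p m * jac m p * (jac p x * unity p (k * x)) * (jac m y * unity m (k * y))"
      using 1 by simp
  qed
  also have "\<dots> = jac p m * jac m p * fourier p (jac p) k * fourier m (jac m) k"
    unfolding fourier_def mult.assoc sum_product by (simp add: sum_distrib_left)
  finally show ?thesis .
qed

text \<open>Squarefreeness makes each split-off prime coprime to the rest, so the transform factors
  over the primes. A single prime factor already kills frequency 0; for \<open>m = 1\<close> the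
  transform is 1.\<close>

lemma fourier_jacobi_squarefree:
  assumes "odd m" "0 < m" "squarefree m"
  shows "norm (fourier m (jac m) k) \<le> sqrt (of_int m)" "1 < m \<Longrightarrow> fourier m (jac m) 0 = 0"
proof -
  have "(\<forall>k. norm (fourier m (jac m) k) \<le> sqrt (of_int m)) \<and> (1 < m \<longrightarrow> fourier m (jac m) 0 = 0)"
    using assms
  proof (induction rule: odd_pos_induct)
    case 1
    have "{0..<1::int} = {0}" by auto
    then show ?case by (simp add: fourier_def)
  next
    case (prime_mult p m)
    have p: "0 < p" using prime_gt_0_int[OF prime_mult.hyps(1)] .
    have "\<not> p dvd m"
    proof
      assume "p dvd m"
      then have "p\<^sup>2 dvd p * m" by (simp add: power2_eq_square)
      then show False using squarefreeD[OF prime_mult.prems] prime_mult.hyps(1) not_prime_unit by blast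
    qed
    then have cop: "coprime p m" using prime_mult.hyps(1) by (rule prime_imp_coprime[rotated])
    have IH: "norm (fourier m (jac m) k) \<le> sqrt (of_int m)" for k
      using prime_mult squarefree_multD(2) by blast
    note fm = fourier_jacobi_mult[OF \<open>odd p\<close> p \<open>odd m\<close> \<open>0 < m\<close> cop]
    have "norm (fourier (p * m) (jac (p * m)) k) \<le> 1 * 1 * sqrt (of_int p) * sqrt (of_int m)" for k
      unfolding fm norm_mult using prime_mult.hyps p
      by (intro mult_mono IH norm_fourier_jacobi_prime_le norm_jac_le_1) auto
    moreover have "fourier (p * m) (jac (p * m)) 0 = 0"
      unfolding fm using fourier_jacobi_prime_0 prime_mult.hyps by simp
    ultimately show ?case by (simp add: real_sqrt_mult)
  qed
  then show "norm (fourier m (jac m) k) \<le> sqrt (of_int m)" "1 < m \<Longrightarrow> fourier m (jac m) 0 = 0"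
    by auto
qed

lemma polya_vinogradov_squarefree:
  assumes "odd m" "1 < m" "squarefree m"
  shows "\<bar>\<Sum>n\<in>{x<..y}. jacobi n m\<bar> \<le> 2 * sqrt (of_int m) * (1 + ln (of_int m))"
proof -
  have "norm (\<Sum>n\<in>{x<..y}. jac m n) \<le> 2 * sqrt (of_int m) * (1 + ln (of_int m))"
    using assms fourier_jacobi_squarefree[of m] by (intro completion_bound) (auto simp: jacobi_mod)
  moreover have "norm (\<Sum>n\<in>{x<..y}. jac m n) = of_int \<bar>\<Sum>n\<in>{x<..y}. jacobi n m\<bar>"
    by (metis norm_of_int of_int_abs of_int_sum)
  ultimately show ?thesis by simp
qed

text \<open>Floor division carries half-open intervals \<open>{x<..y}\<close> to half-open intervals
  of quotients without boundary cases, which is why the sums run over intervals of that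
  shape.\<close>

lemma div_less_iff_int:
  fixes a s j :: int
  assumes "0 < s"
  shows "a div s < j \<longleftrightarrow> a < s * j"
proof
  assume "a div s < j"
  then have "s * (a div s + 1) \<le> s * j" using assms by (intro mult_left_mono) auto
  then show "a < s * j"
    using pos_mod_bound[OF assms, of a] mult_div_mod_eq[of s a]
    by (simp only: distrib_left mult_1_right)
next
  assume *: "a < s * j"
  show "a div s < j"
  proof (rule ccontr)
    assume "\<not> a div s < j"
    then have "s * j \<le> s * (a div s)" using assms by (intro mult_left_mono) auto
    then show False
      using * pos_mod_sign[OF assms, of a] mult_div_mod_eq[of s a] by linarith
  qed
qed

lemma sum_progression:
  fixes f :: "int \<Rightarrow> 'a::comm_monoid_add"
  assumes "0 < s"
  shows "(\<Sum>n\<in>{n\<in>{x<..y}. [n = r] (mod s)}. f n)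
    = (\<Sum>j\<in>{(x - r) div s<..(y - r) div s}. f (s * j + r))"
proof -
  have iff: "j \<in> {(x - r) div s<..(y - r) div s} \<longleftrightarrow> s * j + r \<in> {x<..y}" for j
    using div_less_iff_int[OF assms, of "x - r" j] div_less_iff_int[OF assms, of "y - r" j] by auto
  have "{n\<in>{x<..y}. [n = r] (mod s)} = (\<lambda>j. s * j + r) ` {(x - r) div s<..(y - r) div s}"
  proof (intro equalityI subsetI)
    fix n assume n: "n \<in> {n\<in>{x<..y}. [n = r] (mod s)}"
    then have "[r = n] (mod s)" using cong_sym by blast
    then obtain j where "n = s * j + r"
      unfolding cong_iff_lin by (auto simp: add.commute)
    then show "n \<in> (\<lambda>j. s * j + r) ` {(x - r) div s<..(y - r) div s}"
      using n iff[of j] by blast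
  next
    fix n assume "n \<in> (\<lambda>j. s * j + r) ` {(x - r) div s<..(y - r) div s}"
    then obtain j where "n = s * j + r" "j \<in> {(x - r) div s<..(y - r) div s}" by blast
    then have "n \<in> {x<..y}" "[n = r] (mod s)"
      using iff[of j] by (blast, simp add: cong_def)
    then show "n \<in> {n\<in>{x<..y}. [n = r] (mod s)}" by blast
  qed
  moreover have "inj_on (\<lambda>j. s * j + r) {(x - r) div s<..(y - r) div s}"
    using assms by (auto intro: inj_onI)
  ultimately show ?thesis by (simp add: sum.reindex)
qed

text \<open>With \<open>u\<close> inverse to \<open>s\<close> modulo \<open>m\<close>,
  \<open>s * j + r\<close> is congruent to \<open>s * (j + u * r)\<close>. The progression sum is
  thus a symbol value times a sum over an interval, and the bound does not depend on
  \<open>s\<close>.\<close>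

lemma progression_bound_squarefree:
  assumes "odd m" "1 < m" "squarefree m" "0 < s" "coprime s m"
  shows "\<bar>\<Sum>n\<in>{n\<in>{x<..y}. [n = r] (mod s)}. jacobi n m\<bar> \<le> 2 * sqrt (of_int m) * (1 + ln (of_int m))"
proof -
  obtain u where u: "[s * u = 1] (mod m)" using cong_solve_coprime_int[OF assms(5)] by blast
  define a b where "a = (x - r) div s" and "b = (y - r) div s"
  have shift: "jacobi (s * j + r) m = jacobi s m * jacobi (j + u * r) m" for j
  proof -
    have "[s * u * r = 1 * r] (mod m)" using u by (rule cong_scalar_right)
    then have "[s * j + s * u * r = s * j + r] (mod m)" by (simp add: cong_add_lcancel)
    then have "jacobi (s * j + r) m = jacobi (s * (j + u * r)) m"
      using assms by (intro jacobi_cong) (auto simp: distrib_left mult.assoc cong_sym)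
    then show ?thesis using assms by (simp add: jacobi_mult_left)
  qed
  have "(\<Sum>n\<in>{n\<in>{x<..y}. [n = r] (mod s)}. jacobi n m) = (\<Sum>j\<in>{a<..b}. jacobi (s * j + r) m)"
    unfolding a_def b_def by (rule sum_progression[OF assms(4)])
  also have "\<dots> = jacobi s m * (\<Sum>j\<in>{a<..b}. jacobi (j + u * r) m)"
    by (simp add: shift sum_distrib_left)
  also have "(\<Sum>j\<in>{a<..b}. jacobi (j + u * r) m) = (\<Sum>n\<in>{a + u * r<..b + u * r}. jacobi n m)"
    by (rule sum.reindex_bij_witness[of _ "\<lambda>n. n - u * r" "\<lambda>j. j + u * r"]) auto
  finally have "\<bar>\<Sum>n\<in>{n\<in>{x<..y}. [n = r] (mod s)}. jacobi n m\<bar>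
      \<le> \<bar>\<Sum>n\<in>{a + u * r<..b + u * r}. jacobi n m\<bar>"
    using jacobi_abs_le[of m s] assms by (simp add: abs_mult mult_left_le_one_le)
  then have "real_of_int \<bar>\<Sum>n\<in>{n\<in>{x<..y}. [n = r] (mod s)}. jacobi n m\<bar>
      \<le> real_of_int \<bar>\<Sum>n\<in>{a + u * r<..b + u * r}. jacobi n m\<bar>" by (rule of_int_le_iff[THEN iffD2])
  also have "\<dots> \<le> 2 * sqrt (of_int m) * (1 + ln (of_int m))"
    by (rule polya_vinogradov_squarefree[OF assms(1-3)])
  finally show ?thesis .
qed

lemma jacobi_prime_square_mult:
  assumes "prime p" "0 < k"
  shows "jacobi n (p\<^sup>2 * k) = (if p dvd n then 0 else jacobi n k)"
  using assms prime_gt_0_int[OF assms(1)] Legendre_cases[of n p] Legendre_eq_0_iff[of n p]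
  by (auto simp: power2_eq_square mult.assoc jacobi_prime_mult)

text \<open>Multiples \<open>p * j\<close> in a residue class modulo \<open>s\<close> correspond to
  \<open>j\<close> in another class modulo \<open>s\<close>, because \<open>p\<close> is invertible
  there. Only the existence of that class matters, as the bound to be applied is uniform in
  it.\<close>

lemma sum_progression_multiples:
  assumes "prime p" "coprime p s" "0 < s" "odd k" "0 < k"
  obtains t where "(\<Sum>n\<in>{n\<in>{x<..y}. [n = r] (mod s) \<and> p dvd n}. jacobi n k)
    = jacobi p k * (\<Sum>j\<in>{j\<in>{x div p<..y div p}. [j = t] (mod s)}. jacobi j k)"
proof -
  have p: "0 < p" using prime_gt_0_int[OF assms(1)] .
  obtain u where u: "[p * u = 1] (mod s)" using cong_solve_coprime_int[OF assms(2)] by blast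
  define t where "t = u * r"
  have "[p * u * r = 1 * r] (mod s)" using u by (rule cong_scalar_right)
  then have t: "[p * t = r] (mod s)" by (simp add: t_def mult.assoc)
  have iff1: "p * j \<in> {x<..y} \<longleftrightarrow> j \<in> {x div p<..y div p}" for j
    using div_less_iff_int[OF p, of x j] div_less_iff_int[OF p, of y j] by auto
  have iff2: "[p * j = r] (mod s) \<longleftrightarrow> [j = t] (mod s)" for j
  proof -
    have "[p * j = r] (mod s) \<longleftrightarrow> [p * j = p * t] (mod s)"
      using t by (meson cong_sym cong_trans)
    then show ?thesis using cong_mult_lcancel[OF assms(2)] by simp
  qed
  have eq: "{n\<in>{x<..y}. [n = r] (mod s) \<and> p dvd n}
      = (\<lambda>j. p * j) ` {j\<in>{x div p<..y div p}. [j = t] (mod s)}"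
  proof (intro equalityI subsetI)
    fix n assume n: "n \<in> {n\<in>{x<..y}. [n = r] (mod s) \<and> p dvd n}"
    then obtain j where "n = p * j" by blast
    then show "n \<in> (\<lambda>j. p * j) ` {j\<in>{x div p<..y div p}. [j = t] (mod s)}"
      using n iff1[of j] iff2[of j] by blast
  next
    fix n assume "n \<in> (\<lambda>j. p * j) ` {j\<in>{x div p<..y div p}. [j = t] (mod s)}"
    then obtain j where "n = p * j" "j \<in> {x div p<..y div p}" "[j = t] (mod s)" by blast
    moreover from this have "p * j \<in> {x<..y}" "[p * j = r] (mod s)"
      using iff1[of j] iff2[of j] by blast+
    ultimately show "n \<in> {n\<in>{x<..y}. [n = r] (mod s) \<and> p dvd n}" by simp
  qed
  have "inj_on (\<lambda>j. p * j) {j\<in>{x div p<..y div p}. [j = t] (mod s)}"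
    using p by (auto intro: inj_onI)
  then have "(\<Sum>n\<in>{n\<in>{x<..y}. [n = r] (mod s) \<and> p dvd n}. jacobi n k)
    = jacobi p k * (\<Sum>j\<in>{j\<in>{x div p<..y div p}. [j = t] (mod s)}. jacobi j k)"
    unfolding eq using assms by (simp add: sum.reindex jacobi_mult_left sum_distrib_left)
  then show thesis by (rule that)
qed

text \<open>If $m = p^2 k$, then the symbol modulo $m$ is the one modulo $k$ with the multiples of $p$ removed.
  This at most doubles the bound for $k$, whereas $\sqrt m = p \sqrt k \ge 2 \sqrt k$.\<close>

lemma progression_bound:
  assumes "odd m" "0 < m" "\<nexists>k. m = k\<^sup>2" "0 < s" "coprime s m"
  shows "\<bar>\<Sum>n\<in>{n\<in>{x<..y}. [n = r] (mod s)}. jacobi n m\<bar> \<le> 2 * sqrt (of_int m) * (1 + ln (of_int m))"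
  using assms
proof (induction "nat m" arbitrary: m x y r rule: less_induct)
  case less
  show ?case
  proof (cases "squarefree m")
    case True
    have "m \<noteq> 1" using less.prems(3) by (metis one_power2)
    then show ?thesis using True less.prems by (intro progression_bound_squarefree) auto
  next
    case False
    then obtain p where p: "prime p" "p\<^sup>2 dvd m"
      using less.prems squarefree_factorial_semiring[of m] by auto
    then obtain k where k: "m = p\<^sup>2 * k" by blast
    have p2: "2 \<le> p" using prime_ge_2_int[OF p(1)] .
    have kpos: "0 < k" using less.prems(2) k by (simp add: zero_less_mult_iff)
    have "1 < p\<^sup>2" using p2 power_mono[of 2 p 2] by simp
    then have lt: "k < m" using kpos k by simp
    have oddk: "odd k" using less.prems(1) k by simp
    have nsq: "\<nexists>j. k = j\<^sup>2"
      using less.prems(3) unfolding k by (metis power_mult_distrib)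
    have cop: "coprime s k" "coprime p s"
      using less.prems(5) unfolding k by (simp_all add: coprime_commute)
    let ?A = "{n\<in>{x<..y}. [n = r] (mod s)}"
    let ?B = "2 * sqrt (of_int k) * (1 + ln (of_int k))"
    \<comment> \<open>Stated for all \<open>x\<close>, \<open>y\<close> and \<open>r\<close>: the
      removed multiples of \<open>p\<close> lead to a progression with other endpoints and another
      residue.\<close>
    have IH: "\<bar>\<Sum>n\<in>{n\<in>{x<..y}. [n = r] (mod s)}. jacobi n k\<bar> \<le> ?B" for x y r
      using less.hyps[of k] lt kpos oddk nsq cop(1) less.prems(4) by simp
    obtain t where t: "(\<Sum>n\<in>{n\<in>{x<..y}. [n = r] (mod s) \<and> p dvd n}. jacobi n k)
      = jacobi p k * (\<Sum>j\<in>{j\<in>{x div p<..y div p}. [j = t] (mod s)}. jacobi j k)" (is "?P = _ * ?J")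
      using sum_progression_multiples[OF p(1) cop(2) less.prems(4) oddk kpos] by blast
    have "(\<Sum>n\<in>?A. jacobi n m) = (\<Sum>n\<in>?A. jacobi n k - (if p dvd n then jacobi n k else 0))"
      unfolding k using p(1) kpos by (intro sum.cong) (auto simp: jacobi_prime_square_mult)
    also have "\<dots> = (\<Sum>n\<in>?A. jacobi n k) - (\<Sum>n\<in>?A. if p dvd n then jacobi n k else 0)"
      by (rule sum_subtractf)
    also have "(\<Sum>n\<in>?A. if p dvd n then jacobi n k else 0) = (\<Sum>n\<in>{n\<in>?A. p dvd n}. jacobi n k)"
      by (intro sum.inter_filter[symmetric] finite_subset[of ?A "{x<..y}"]) auto
    also have "{n\<in>?A. p dvd n} = {n\<in>{x<..y}. [n = r] (mod s) \<and> p dvd n}" by blast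
    finally have "\<bar>\<Sum>n\<in>?A. jacobi n m\<bar> \<le> \<bar>\<Sum>n\<in>?A. jacobi n k\<bar> + \<bar>?P\<bar>" by simp
    also have "\<bar>?P\<bar> \<le> \<bar>?J\<bar>"
      unfolding t using jacobi_abs_le[of k p] oddk kpos by (simp add: abs_mult mult_left_le_one_le)
    finally have "real_of_int \<bar>\<Sum>n\<in>?A. jacobi n m\<bar> \<le> of_int (\<bar>\<Sum>n\<in>?A. jacobi n k\<bar> + \<bar>?J\<bar>)"
      by (simp only: of_int_le_iff)
    also have "\<dots> \<le> ?B + ?B"
      unfolding of_int_add by (intro add_mono IH)
    also have "\<dots> = 2 * (2 * sqrt (of_int k)) * (1 + ln (of_int k))" by simp
    also have "\<dots> \<le> 2 * (of_int p * sqrt (of_int k)) * (1 + ln (of_int m))"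
      using p2 kpos lt by (intro mult_mono add_mono) auto
    also have "of_int p * sqrt (of_int k) = sqrt (of_int m)"
      using p2 unfolding k by (simp add: real_sqrt_mult)
    finally show ?thesis .
  qed
qed

section \<open>Counting coprime integers\<close>

definition coprime_count :: "nat \<Rightarrow> nat \<Rightarrow> nat" where
  "coprime_count q N = card {n\<in>{0<..N}. coprime n q}"

text \<open>The first \<open>q\<close> integers contribute \<open>totient q\<close>, and the rest is
  a translate of the count up to \<open>N\<close>.\<close>

lemma coprime_count_add: "coprime_count q (N + q) = coprime_count q N + totient q"
proof -
  have shift: "coprime (m + q) q = coprime m q" for m
    by (simp only: coprime_iff_gcd_eq_1 gcd_add1)
  have "{n\<in>{0<..N + q}. coprime n q} = totatives q \<union> (\<lambda>n. n + q) ` {n\<in>{0<..N}. coprime n q}" (is "_ = _ \<union> ?B")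
  proof (intro equalityI subsetI)
    fix n assume n: "n \<in> {n\<in>{0<..N + q}. coprime n q}"
    show "n \<in> totatives q \<union> ?B"
    proof (cases "n \<le> q")
      case False
      then obtain m where m: "n = m + q" by (metis le_add_diff_inverse2 nat_le_linear)
      then have "m \<in> {n\<in>{0<..N}. coprime n q}"
        using n False by (simp add: shift)
      then show ?thesis using m by blast
    qed (use n in \<open>simp add: totatives_def\<close>)
  qed (auto simp: totatives_def shift)
  moreover have "totatives q \<inter> ?B = {}" by (auto simp: totatives_def)
  ultimately show ?thesis
    by (simp add: coprime_count_def card_Un_disjoint card_image totient_def)
qed

text \<open>Removing a full period changes both terms by exactly \<open>totient q\<close>, so the
  error stems from the final piece with \<open>N < q\<close>.\<close>

lemma coprime_count_approx:
  assumes "0 < q"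
  shows "\<bar>real (coprime_count q N) - real N * (totient q / q)\<bar> \<le> q"
proof (induction N rule: less_induct)
  case (less N)
  show ?case
  proof (cases "N < q")
    case True
    have "coprime_count q N \<le> card {0<..N}" unfolding coprime_count_def by (intro card_mono) auto
    then have 1: "real (coprime_count q N) \<le> q" using True by simp
    have "totient q / q \<le> 1" using assms totient_le[of q] by simp
    then have "real N * (totient q / q) \<le> real q * 1" using True by (intro mult_mono) auto
    moreover have "0 \<le> real N * (totient q / q)" by simp
    ultimately show ?thesis using 1 unfolding abs_le_iff by linarith
  next
    case False
    then have N: "N = (N - q) + q" by simp
    have "real (coprime_count q N) = coprime_count q (N - q) + totient q"
      by (subst N) (simp only: coprime_count_add of_nat_add)
    moreover have "real N * (totient q / q) = real (N - q) * (totient q / q) + totient q"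
      using False assms by (simp add: of_nat_diff field_simps)
    ultimately show ?thesis using less.IH[of "N - q"] False assms by simp
  qed
qed

text \<open>Odd means coprime to 2, so both conditions merge into one.\<close>

lemma card_odd_coprime:
  assumes "0 \<le> N"
  shows "card {n\<in>{0<..N}. odd n \<and> coprime n (int k)} = coprime_count (2 * k) (nat N)"
proof -
  have "{n\<in>{0<..N}. odd n \<and> coprime n (int k)} = int ` {n\<in>{0<..nat N}. coprime n (2 * k)}"
  proof (intro equalityI subsetI)
    fix n assume n: "n \<in> {n\<in>{0<..N}. odd n \<and> coprime n (int k)}"
    then have "n = int (nat n)" by simp
    moreover have "coprime (nat n) (2 * k)"
      using n by (metis \<open>n = int (nat n)\<close> coprime_int_iff coprime_mult_right_iff coprime_right_2_iff_odd
          even_of_nat mem_Collect_eq)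
    ultimately show "n \<in> int ` {n\<in>{0<..nat N}. coprime n (2 * k)}"
      using n assms by (intro image_eqI[of _ _ "nat n"]) auto
  qed (use assms in auto)
  then show ?thesis by (simp add: coprime_count_def card_image)
qed

lemma card_odd_coprime_approx:
  assumes "0 \<le> N" "odd k"
  shows "\<bar>real (card {n\<in>{0<..N}. odd n \<and> coprime n (int k)}) - of_int N * (totient k / (2 * k))\<bar> \<le> 2 * k"
proof -
  have "0 < k" using assms(2) by (rule odd_pos)
  moreover have "totient (2 * k) = totient k"
    using assms(2) by (subst totient_mult_coprime) auto
  ultimately show ?thesis
    using coprime_count_approx[of "2 * k" "nat N"] assms(1)
    unfolding card_odd_coprime[OF assms(1)] by simp
qed

section \<open>The Dirichlet series of the totient function over odd integers\<close>

text \<open>The term at \<^term>\<open>n = 0\<close> is \<^term>\<open>1 / 0 = (0::real)\<close>, so sums over all naturals may start at 0.\<close>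

lemma zeta_nat_sums:
  assumes "2 \<le> s"
  shows "(\<lambda>n. 1 / real n ^ s) sums zeta (real s)"
proof -
  have "summable (\<lambda>n. 1 / real n ^ s)"
    using inverse_power_summable[OF assms, where 'a = real] by (simp add: field_simps)
  then have "summable (\<lambda>n. 1 / real (Suc n) ^ s)" by (subst summable_Suc_iff)
  then have "(\<lambda>n. 1 / real (Suc n) ^ s) sums zeta (real s)"
    by (simp add: zeta_def powr_realpow summable_sums)
  then have "(\<lambda>n. 1 / real n ^ s) sums (zeta (real s) + 1 / real 0 ^ s)" by (rule sums_Suc)
  then show ?thesis using assms by (simp add: power_0_left)
qed

text \<open>The even terms form a copy of the whole series scaled by
  \<open>1 / 2 ^ s\<close>.\<close>

lemma has_sum_zeta_odd:
  assumes "2 \<le> s"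
  shows "((\<lambda>n. 1 / real n ^ s) has_sum ((1 - 1 / 2 ^ s) * zeta (real s))) {n. odd n}"
proof -
  let ?f = "\<lambda>n::nat. 1 / real n ^ s"
  have all: "(?f has_sum zeta (real s)) UNIV"
    using zeta_nat_sums[OF assms] by (intro norm_summable_imp_has_sum) (auto simp: sums_iff)
  have "((\<lambda>n. 1 / 2 ^ s * ?f n) has_sum (1 / 2 ^ s * zeta (real s))) UNIV"
    by (rule has_sum_cmult_right[OF all])
  then have "((?f \<circ> (*) 2) has_sum (1 / 2 ^ s * zeta (real s))) UNIV"
    by (simp add: o_def power_mult_distrib)
  then have "(?f has_sum (1 / 2 ^ s * zeta (real s))) (range ((*) 2))"
    by (subst has_sum_reindex) (auto intro: inj_onI)
  then have "(?f has_sum (zeta (real s) - 1 / 2 ^ s * zeta (real s))) (UNIV - range ((*) 2))"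
    by (intro has_sum_Diff[OF all]) auto
  moreover have "UNIV - range ((*) 2) = {n::nat. odd n}" by (auto elim: evenE)
  ultimately show ?thesis by (simp add: left_diff_distrib)
qed

lemma zeta_pos:
  assumes "2 \<le> s"
  shows "0 < zeta (real s)"
proof -
  have "(\<Sum>n<2. 1 / real n ^ s) \<le> (\<Sum>n. 1 / real n ^ s)"
    using zeta_nat_sums[OF assms] by (intro sum_le_suminf) (auto simp: sums_iff)
  also have "\<dots> = zeta (real s)" using zeta_nat_sums[OF assms] by (simp add: sums_iff)
  finally have "(\<Sum>n<2. 1 / real n ^ s) \<le> zeta (real s)" .
  then show ?thesis using assms by (simp add: numeral_2_eq_2 power_0_left)
qed

lemma totient_cubed_le: "real (totient k) / real k ^ 3 \<le> 1 / real k ^ 2"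
proof (cases "k = 0")
  case False
  have "real (totient k) / real k ^ 3 \<le> real k / real k ^ 3"
    using totient_le by (intro divide_right_mono) auto
  also have "\<dots> = 1 / real k ^ 2" using False by (simp add: power2_eq_square power3_eq_cube)
  finally show ?thesis .
qed simp

text \<open>Multiplying by $\sum_{d \text{ odd}} d^{-3}$ and grouping by $n = kd$ turns the series into
  $\sum_{n \text{ odd}} n^{-2}$, because $\sum_{k \mid n} \varphi(k) = n$.\<close>

lemma has_sum_totient_odd:
  "((\<lambda>k. real (totient k) / real k ^ 3) has_sum (6 * zeta 2 / (7 * zeta 3))) {k. odd k}"
proof -
  let ?A = "{k::nat. odd k}"
  let ?f = "\<lambda>k. real (totient k) / real k ^ 3" and ?h = "\<lambda>d::nat. 1 / real d ^ 3"
  \<comment> \<open>The factors 3/4 and 7/8 are 1 - 2^(-2) and 1 - 2^(-3); their quotient is the 6/7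
    of the theorem.\<close>
  have Z2: "((\<lambda>n. 1 / real n ^ 2) has_sum (3 / 4 * zeta 2)) ?A"
    using has_sum_zeta_odd[of 2] by simp
  have Z3: "(?h has_sum (7 / 8 * zeta 3)) ?A"
    using has_sum_zeta_odd[of 3] by simp
  have "?f summable_on ?A"
    by (rule summable_on_comparison_test[OF has_sum_imp_summable[OF Z2] totient_cubed_le]) simp
  then obtain D where D: "(?f has_sum D) ?A" by (auto simp: summable_on_def)
  have inner: "((\<lambda>d. (\<lambda>(k, d). ?f k * ?h d) (k, d)) has_sum (?f k * (7 / 8 * zeta 3))) ?A" for k
    unfolding prod.case by (rule has_sum_cmult_right[OF Z3])
  have outer: "((\<lambda>k. ?f k * (7 / 8 * zeta 3)) has_sum (D * (7 / 8 * zeta 3))) ?A"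
    by (rule has_sum_cmult_left[OF D])
  \<comment> \<open>All terms are nonnegative, so summability of the iterated sums gives summability
    over the product, and the pairs may be regrouped.\<close>
  have prod: "((\<lambda>(k, d). ?f k * ?h d) has_sum (D * (7 / 8 * zeta 3))) (?A \<times> ?A)"
    by (rule has_sum_SigmaI[OF inner outer summable_on_SigmaI[OF inner has_sum_imp_summable[OF outer]]])
      simp
  have odd_div: "odd k \<and> odd (n div k)" if "odd n" "k dvd n" for n k :: nat
    using that by (metis dvd_mult_div_cancel even_mult_iff)
  let ?g = "\<lambda>(n, k). real (totient k) / real n ^ 3"
  have "((\<lambda>(k, d). ?f k * ?h d) has_sum (D * (7 / 8 * zeta 3))) (?A \<times> ?A)
    \<longleftrightarrow> (?g has_sum (D * (7 / 8 * zeta 3))) (SIGMA n:?A. {k. k dvd n})"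
    by (rule has_sum_reindex_bij_witness[of _ "\<lambda>(n, k). (k, n div k)" "\<lambda>(k, d). (k * d, k)"])
      (auto simp: power_mult_distrib odd_pos odd_div)
  with prod have sig: "(?g has_sum (D * (7 / 8 * zeta 3))) (SIGMA n:?A. {k. k dvd n})" by simp
  have "((\<lambda>n. 1 / real n ^ 2) has_sum (D * (7 / 8 * zeta 3))) ?A"
  proof (rule has_sum_SigmaD[OF sig])
    fix n :: nat assume "n \<in> ?A"
    then have n: "0 < n" by (simp add: odd_pos)
    have "(\<Sum>k | k dvd n. real (totient k) / real n ^ 3) = real (\<Sum>k | k dvd n. totient k) / real n ^ 3"
      by (simp add: sum_divide_distrib)
    also have "\<dots> = 1 / real n ^ 2"
      using n by (simp add: totient_divisor_sum power2_eq_square power3_eq_cube)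
    finally show "((\<lambda>k. ?g (n, k)) has_sum (1 / real n ^ 2)) {k. k dvd n}"
      using n by (intro has_sum_finiteI) auto
  qed
  then have "D * (7 / 8 * zeta 3) = 3 / 4 * zeta 2" using Z2 has_sum_unique by blast
  then have "D = 6 * zeta 2 / (7 * zeta 3)" using zeta_pos[of 3] by (simp add: field_simps)
  with D show ?thesis by simp
qed

text \<open>Telescoping, by 1/(n + 1)^2 <= 1/n - 1/(n + 1).\<close>

lemma sum_inverse_squares_tail:
  assumes "0 < K" "K \<le> N"
  shows "(\<Sum>k\<in>{K<..N}. 1 / real k ^ 2) \<le> 1 / real K - 1 / real N"
  using assms(2)
proof (induction N rule: dec_induct)
  case (step N)
  have N: "0 < N" using step assms(1) by simp
  have "{K<..Suc N} = insert (Suc N) {K<..N}" using step by auto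
  then have "(\<Sum>k\<in>{K<..Suc N}. 1 / real k ^ 2) \<le> 1 / real (Suc N) ^ 2 + (1 / real K - 1 / real N)"
    using step.IH by simp
  also have "1 / real (Suc N) ^ 2 \<le> 1 / real N - 1 / real (Suc N)"
  proof -
    have "1 / real (Suc N) ^ 2 \<le> 1 / (real N * real (Suc N))"
      using N by (intro divide_left_mono) (auto simp: power2_eq_square)
    also have "\<dots> = 1 / real N - 1 / real (Suc N)" using N by (simp add: field_simps)
    finally show ?thesis .
  qed
  finally show ?case by simp
qed simp

lemma totient_series_tail:
  assumes "0 < K"
  shows "\<bar>6 * zeta 2 / (7 * zeta 3) - (\<Sum>k | odd k \<and> k \<le> K. real (totient k) / real k ^ 3)\<bar> \<le> 1 / real K"
proof -
  let ?f = "\<lambda>k. real (totient k) / real k ^ 3"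
  let ?S = "\<Sum>k | odd k \<and> k \<le> K. ?f k"
  have fin: "finite {k. odd k \<and> k \<le> K}" by (rule finite_subset[of _ "{..K}"]) auto
  have "(?f has_sum (6 * zeta 2 / (7 * zeta 3) - ?S)) ({k. odd k} - {k. odd k \<and> k \<le> K})"
    using fin by (intro has_sum_Diff has_sum_totient_odd has_sum_finite) auto
  moreover have "{k. odd k} - {k. odd k \<and> k \<le> K} = {k. odd k \<and> K < k}" by auto
  ultimately have tail: "(?f has_sum (6 * zeta 2 / (7 * zeta 3) - ?S)) {k. odd k \<and> K < k}" by simp
  have "0 \<le> 6 * zeta 2 / (7 * zeta 3) - ?S"
    by (rule has_sum_nonneg[OF tail]) simp
  moreover have "6 * zeta 2 / (7 * zeta 3) - ?S \<le> 1 / real K"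
  proof (rule has_sum_le_finite_sums[OF tail])
    fix F assume F: "finite F" "F \<subseteq> {k. odd k \<and> K < k}"
    \<comment> \<open>An arbitrary finite part of the tail is enclosed in an interval, where the
      telescoping bound applies.\<close>
    define N where "N = Max (insert K F)"
    have "K \<le> N" "F \<subseteq> {K<..N}" using F by (auto simp: N_def)
    then have "sum ?f F \<le> sum ?f {K<..N}" by (intro sum_mono2) auto
    also have "\<dots> \<le> (\<Sum>k\<in>{K<..N}. 1 / real k ^ 2)" by (intro sum_mono totient_cubed_le)
    also have "\<dots> \<le> 1 / real K - 1 / real N" using assms \<open>K \<le> N\<close> by (rule sum_inverse_squares_tail)
    finally show "sum ?f F \<le> 1 / real K" using assms \<open>K \<le> N\<close> by (simp add: order_trans)
  qed
  ultimately show ?thesis by simp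
qed

section \<open>The hyperbola method\<close>

text \<open>The lower end is excluded, so that \<open>odds M y\<close> takes exactly the entries
  above \<open>M\<close> and no pair of the hyperbola is counted twice.\<close>

definition odds :: "int \<Rightarrow> int \<Rightarrow> int set" where
  "odds x y = {n\<in>{x<..y}. odd n}"

lemma finite_odds [simp]: "finite (odds x y)"
  unfolding odds_def by (rule finite_subset[of _ "{x<..y}"]) auto

text \<open>The second summand collects the pairs $(m, n)$ with $n > M$: after reciprocity, the smaller
  entry is the modulus there as well.\<close>

definition hyperbola_sum :: "int \<Rightarrow> int \<Rightarrow> int \<Rightarrow> int" where
  "hyperbola_sum M N m = (\<Sum>n\<in>odds 0 (N div m). jacobi n m)
    + (\<Sum>n\<in>odds M (N div m). rsign n m * jacobi n m)"

lemma sum_jacobi_hyperbola: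
  assumes "0 \<le> M" "N < (M + 1)\<^sup>2"
  shows "(\<Sum>(n, m)\<in>{(n, m). 0 < n \<and> 0 < m \<and> odd n \<and> odd m \<and> n * m \<le> N}. jacobi n m)
    = (\<Sum>m\<in>odds 0 M. hyperbola_sum M N m)"
proof -
  let ?P = "\<lambda>n m. 0 < n \<and> 0 < m \<and> odd n \<and> odd m \<and> n * m \<le> N"
  let ?Q1 = "{(n, m). ?P n m \<and> m \<le> M}" and ?Q2 = "{(n, m). ?P n m \<and> M < m}"
  let ?S1 = "Sigma (odds 0 M) (\<lambda>m. odds 0 (N div m))" and ?S2 = "Sigma (odds 0 M) (\<lambda>m. odds M (N div m))"
  have le_div: "n \<le> N div m \<longleftrightarrow> n * m \<le> N" if "0 < m" for n m
    using div_less_iff_int[OF that, of N n] by (simp add: mult.commute not_less[symmetric])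
  have small: "n \<le> M" if "?P n m" "M < m" for n m
  proof (rule ccontr)
    assume "\<not> n \<le> M"
    then have "(M + 1) * (M + 1) \<le> n * m" using that assms by (intro mult_mono) auto
    then show False using that assms by (simp add: power2_eq_square)
  qed
  have Q1: "?Q1 = prod.swap ` ?S1"
  proof (intro equalityI subsetI)
    fix z assume "z \<in> ?Q1"
    then have "prod.swap z \<in> ?S1" by (auto simp: odds_def le_div)
    then show "z \<in> prod.swap ` ?S1" by (intro image_eqI[of _ _ "prod.swap z"]) simp_all
  qed (auto simp: odds_def le_div)
  \<comment> \<open>Unlike \<open>?Q1\<close>, this part is not swapped: its small first entry takes
    the place of the modulus.\<close>
  have "(n, m) \<in> ?Q2 \<longleftrightarrow> (n, m) \<in> ?S2" for n m
  proof (cases "0 < n \<and> M < m")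
    case True
    then have "0 < m" using assms(1) by simp
    then show ?thesis
      using True small[of n m] le_div[of n m] by (auto simp: odds_def mult.commute le_div)
  qed (auto simp: odds_def)
  then have Q2: "?Q2 = ?S2" by auto
  have fin: "finite ?S1" "finite ?S2" by auto
  have fin': "finite ?Q1" "finite ?Q2" unfolding Q1 Q2 by (rule finite_imageI fin)+
  have Q: "{(n, m). ?P n m} = ?Q1 \<union> ?Q2" by auto
  have "(\<Sum>(n, m)\<in>{(n, m). ?P n m}. jacobi n m)
      = (\<Sum>(n, m)\<in>?Q1. jacobi n m) + (\<Sum>(n, m)\<in>?Q2. jacobi n m)"
    unfolding Q by (rule sum.union_disjoint[OF fin']) auto
  also have "(\<Sum>(n, m)\<in>?Q1. jacobi n m) = (\<Sum>(m, n)\<in>?S1. jacobi n m)"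
    unfolding Q1 by (subst sum.reindex) (auto simp: case_prod_unfold)
  also have "(\<Sum>(n, m)\<in>?Q2. jacobi n m) = (\<Sum>(m, n)\<in>?S2. rsign n m * jacobi n m)"
    unfolding Q2
  proof (intro sum.cong refl, clarify)
    fix n m assume "n \<in> odds 0 M" "m \<in> odds M (N div n)"
    then show "jacobi n m = rsign m n * jacobi m n"
      using jacobi_reciprocity[of n m] assms(1) by (simp add: odds_def rsign_commute)
  qed
  also have "(\<Sum>(m, n)\<in>?S1. jacobi n m) + (\<Sum>(m, n)\<in>?S2. rsign n m * jacobi n m)
      = (\<Sum>m\<in>odds 0 M. hyperbola_sum M N m)"
    unfolding hyperbola_sum_def by (simp add: sum.Sigma sum.distrib)
  finally show ?thesis .
qed

text \<open>The sign is constant on each of the classes 1 and 3 modulo 4, and 4 is coprime to the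
  odd modulus; the bound is twice that of \<open>progression_bound\<close>.\<close>

lemma odds_sum_bound:
  assumes m: "odd m" "0 < m" "\<nexists>k. m = k\<^sup>2"
    and a: "\<And>n. [n = 1] (mod 4) \<Longrightarrow> \<epsilon> n = a" "\<bar>a\<bar> = 1"
    and b: "\<And>n. [n = 3] (mod 4) \<Longrightarrow> \<epsilon> n = b" "\<bar>b\<bar> = 1"
  shows "\<bar>\<Sum>n\<in>odds x y. \<epsilon> n * jacobi n m\<bar> \<le> 4 * sqrt (of_int m) * (1 + ln (of_int m))"
proof -
  let ?A = "\<lambda>r. {n\<in>{x<..y}. [n = r] (mod 4)}"
  have fin: "finite (?A r)" for r by (rule finite_subset[of _ "{x<..y}"]) auto
  have eq: "odds x y = ?A 1 \<union> ?A 3"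
    unfolding odds_def cong_def by (auto dest: odd_mod_4) presburger+
  have disj: "?A 1 \<inter> ?A 3 = {}" by (auto simp: cong_def)
  have cop: "coprime 4 m" using m(1) coprime_power_left_iff[of 2 2 m] by simp
  have "(\<Sum>n\<in>odds x y. \<epsilon> n * jacobi n m)
      = (\<Sum>n\<in>?A 1. \<epsilon> n * jacobi n m) + (\<Sum>n\<in>?A 3. \<epsilon> n * jacobi n m)"
    unfolding eq by (rule sum.union_disjoint[OF fin fin disj])
  also have "\<dots> = a * (\<Sum>n\<in>?A 1. jacobi n m) + b * (\<Sum>n\<in>?A 3. jacobi n m)"
    unfolding sum_distrib_left by (intro arg_cong2[of _ _ _ _ "(+)"] sum.cong refl) (auto simp: a b)
  finally have split: "(\<Sum>n\<in>odds x y. \<epsilon> n * jacobi n m)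
      = a * (\<Sum>n\<in>?A 1. jacobi n m) + b * (\<Sum>n\<in>?A 3. jacobi n m)" .
  have "\<bar>\<Sum>n\<in>odds x y. \<epsilon> n * jacobi n m\<bar>
      \<le> \<bar>a * (\<Sum>n\<in>?A 1. jacobi n m)\<bar> + \<bar>b * (\<Sum>n\<in>?A 3. jacobi n m)\<bar>"
    unfolding split by (rule abs_triangle_ineq)
  also have "\<dots> = \<bar>\<Sum>n\<in>?A 1. jacobi n m\<bar> + \<bar>\<Sum>n\<in>?A 3. jacobi n m\<bar>"
    by (simp only: abs_mult a(2) b(2) mult_1)
  finally have "real_of_int \<bar>\<Sum>n\<in>odds x y. \<epsilon> n * jacobi n m\<bar>
      \<le> of_int \<bar>\<Sum>n\<in>?A 1. jacobi n m\<bar> + of_int \<bar>\<Sum>n\<in>?A 3. jacobi n m\<bar>"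
    unfolding of_int_add[symmetric] of_int_le_iff .
  moreover have "real_of_int \<bar>\<Sum>n\<in>?A r. jacobi n m\<bar> \<le> 2 * sqrt (of_int m) * (1 + ln (of_int m))" for r
    by (rule progression_bound[OF m _ cop]) simp
  from this[of 1] this[of 3] have "of_int \<bar>\<Sum>n\<in>?A 1. jacobi n m\<bar> + of_int \<bar>\<Sum>n\<in>?A 3. jacobi n m\<bar>
      \<le> 4 * sqrt (of_int m) * (1 + ln (real_of_int m))" by linarith
  ultimately show ?thesis by linarith
qed

lemma hyperbola_sum_nonsquare:
  assumes "odd m" "0 < m" "\<nexists>k. m = k\<^sup>2"
  shows "\<bar>hyperbola_sum M N m\<bar> \<le> 8 * sqrt (of_int m) * (1 + ln (of_int m))"
proof -
  have "real_of_int \<bar>\<Sum>n\<in>odds 0 (N div m). 1 * jacobi n m\<bar> \<le> 4 * sqrt (of_int m) * (1 + ln (of_int m))"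
    by (rule odds_sum_bound[OF assms, of _ 1 1]) auto
  moreover have "real_of_int \<bar>\<Sum>n\<in>odds M (N div m). rsign n m * jacobi n m\<bar>
      \<le> 4 * sqrt (of_int m) * (1 + ln (of_int m))"
    by (rule odds_sum_bound[OF assms, of _ 1 "if m mod 4 = 3 then - 1 else 1"])
      (auto simp: rsign_def cong_def)
  ultimately show ?thesis unfolding hyperbola_sum_def by simp
qed

text \<open>An odd square is 1 modulo 4, so the sign is trivial and both inner sums count odd
  integers coprime to \<open>k\<close>. With \<open>G\<close> as counting function the value is
  \<open>2 * G X - G M\<close>, and \<open>2 * G X\<close> yields the main term. The errors add up
  to at most 6k + M/2 + 1, below 9M because k and 1 are at most M.\<close>

lemma hyperbola_sum_square:
  fixes T :: real
  assumes "odd k" "int k ^ 2 \<le> M" "M\<^sup>2 \<le> \<lfloor>T\<rfloor>"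
  shows "\<bar>hyperbola_sum M \<lfloor>T\<rfloor> (int k ^ 2) - T * (totient k / real k ^ 3)\<bar> \<le> 9 * of_int M"
proof -
  define m where "m = int k ^ 2"
  define X where "X = \<lfloor>T\<rfloor> div m"
  define G where "G y = real (card {n\<in>{0<..y}. odd n \<and> coprime n (int k)})" for y
  define \<alpha> where "\<alpha> = totient k / (2 * real k)"
  have k: "0 < k" using assms(1) by (rule odd_pos)
  then have m: "0 < m" by (simp add: m_def)
  have M: "1 \<le> M" "k \<le> M"
  proof -
    have "int k * 1 \<le> int k * int k" using k by (intro mult_left_mono) auto
    then show "k \<le> M" using assms(2) by (simp add: power2_eq_square)
    then show "1 \<le> M" using k by simp
  qed
  have "M * m \<le> M * M" using M assms(2) by (intro mult_left_mono) (auto simp: m_def)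
  then have "m * M \<le> \<lfloor>T\<rfloor>" using assms(3) by (simp add: power2_eq_square mult.commute)
  \<comment> \<open>This allows the count up to \<open>X\<close> to be split at
    \<open>M\<close>.\<close>
  then have MX: "M \<le> X" using div_less_iff_int[OF m, of "\<lfloor>T\<rfloor>" M] by (simp add: X_def not_less[symmetric])
  have jac_m: "jacobi n m = (if coprime n (int k) then 1 else 0)" for n
    using jacobi_square_right[of "int k" n] assms(1) k by (simp add: m_def)
  have "m mod 4 = 1"
    using mod_4_mult[of "int k" "int k"] assms(1) by (simp add: m_def power2_eq_square)
  then have rs: "rsign n m = 1" for n by (simp add: rsign_def)
  have sum_eq: "(\<Sum>n\<in>odds x y. jacobi n m) = int (card {n\<in>{x<..y}. odd n \<and> coprime n (int k)})" for x y
  proof -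
    have "(\<Sum>n\<in>odds x y. jacobi n m) = (\<Sum>n\<in>{n\<in>odds x y. coprime n (int k)}. 1)"
      unfolding jac_m by (rule sum.inter_filter[symmetric]) simp
    also have "{n\<in>odds x y. coprime n (int k)} = {n\<in>{x<..y}. odd n \<and> coprime n (int k)}"
      by (auto simp: odds_def)
    finally show ?thesis by simp
  qed
  have "G X = G M + card {n\<in>{M<..X}. odd n \<and> coprime n (int k)}"
  proof -
    have fin: "finite {n\<in>{x<..y}. odd n \<and> coprime n (int k)}" for x y
      by (rule finite_subset[of _ "{x<..y}"]) auto
    have "{n\<in>{0<..X}. odd n \<and> coprime n (int k)}
      = {n\<in>{0<..M}. odd n \<and> coprime n (int k)} \<union> {n\<in>{M<..X}. odd n \<and> coprime n (int k)}"
      using MX M by auto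
    moreover have "card \<dots> = card {n\<in>{0<..M}. odd n \<and> coprime n (int k)}
      + card {n\<in>{M<..X}. odd n \<and> coprime n (int k)}"
      by (rule card_Un_disjoint[OF fin fin]) auto
    ultimately show ?thesis unfolding G_def of_nat_add[symmetric] by (simp only:)
  qed
  then have hyp: "real_of_int (hyperbola_sum M \<lfloor>T\<rfloor> m) = 2 * G X - G M"
    unfolding hyperbola_sum_def X_def[symmetric] rs mult_1 sum_eq by (simp add: G_def)
  have GX: "\<bar>G X - of_int X * \<alpha>\<bar> \<le> 2 * k" and GM: "\<bar>G M - of_int M * \<alpha>\<bar> \<le> 2 * k"
    using MX M card_odd_coprime_approx[OF _ assms(1), of X, folded G_def \<alpha>_def]
      card_odd_coprime_approx[OF _ assms(1), of M, folded G_def \<alpha>_def] by simp_all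
  have \<alpha>: "0 \<le> \<alpha>" "\<alpha> \<le> 1 / 2" using k totient_le[of k] by (simp_all add: \<alpha>_def field_simps)
  have main: "T * (totient k / real k ^ 3) = 2 * \<alpha> * (T / of_int m)"
    by (simp add: \<alpha>_def m_def power2_eq_square power3_eq_cube mult_ac)
  have "\<bar>of_int X - T / of_int m\<bar> \<le> 1"
  proof -
    have "m * X \<le> \<lfloor>T\<rfloor>" "\<lfloor>T\<rfloor> < m * (X + 1)"
      using div_less_iff_int[OF m, of "\<lfloor>T\<rfloor>" X] div_less_iff_int[OF m, of "\<lfloor>T\<rfloor>" "X + 1"]
      by (auto simp: X_def)
    then have "of_int (m * X) \<le> T" "T < of_int (m * (X + 1))"
      by (simp_all only: le_floor_iff floor_less_iff)
    then have "of_int X \<le> T / of_int m" "T / of_int m < of_int X + 1"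
      using m by (simp_all add: field_simps)
    then show ?thesis by linarith
  qed
  then have "2 * \<alpha> * \<bar>of_int X - T / of_int m\<bar> \<le> 2 * (1 / 2) * 1" using \<alpha> by (intro mult_mono) auto
  then have "\<bar>2 * \<alpha> * (of_int X - T / of_int m)\<bar> \<le> 1" using \<alpha> by (simp add: abs_mult)
  then have 1: "\<bar>2 * (of_int X * \<alpha>) - 2 * \<alpha> * (T / of_int m)\<bar> \<le> 1"
    by (simp add: right_diff_distrib mult_ac)
  have 2: "0 \<le> of_int M * \<alpha>" "of_int M * \<alpha> \<le> of_int M * (1 / 2)"
    using M \<alpha> by (auto intro: mult_left_mono)
  have "real k \<le> of_int M" "1 \<le> real_of_int M" using M by linarith+
  then show ?thesis
    unfolding m_def[symmetric] hyp main using 1 2 GX GM unfolding abs_le_iff by linarith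
qed

lemma sum_hyperbola_sum:
  fixes T :: real
  assumes "1 \<le> M" "M\<^sup>2 \<le> \<lfloor>T\<rfloor>"
  shows "\<bar>(\<Sum>m\<in>odds 0 M. hyperbola_sum M \<lfloor>T\<rfloor> m)
      - T * (\<Sum>k | odd k \<and> k \<le> nat \<lfloor>sqrt M\<rfloor>. totient k / real k ^ 3)\<bar>
    \<le> of_int M * (8 * sqrt M * (1 + ln M)) + sqrt M * (9 * of_int M)"
proof -
  define K where "K = nat \<lfloor>sqrt M\<rfloor>"
  define A where "A = {k. odd k \<and> k \<le> K}"
  let ?h = "\<lambda>m. real_of_int (hyperbola_sum M \<lfloor>T\<rfloor> m)" and ?sq = "\<lambda>k::nat. int k ^ 2"
  have finA: "finite A" unfolding A_def by (rule finite_subset[of _ "{..K}"]) auto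
  \<comment> \<open>Truncating at the floor of \<open>sqrt M\<close> is exactly the condition that
    the square modulus is at most \<open>M\<close>.\<close>
  have K_iff: "k \<le> K \<longleftrightarrow> int k ^ 2 \<le> M" for k
  proof -
    have "k \<le> K \<longleftrightarrow> real k \<le> sqrt M"
      using assms(1) by (simp add: K_def le_nat_iff le_floor_iff)
    also have "\<dots> \<longleftrightarrow> sqrt (of_int (int k ^ 2)) \<le> sqrt M" by simp
    also have "\<dots> \<longleftrightarrow> int k ^ 2 \<le> M" by (simp only: real_sqrt_le_iff of_int_le_iff)
    finally show ?thesis .
  qed
  have sub: "?sq ` A \<subseteq> odds 0 M"
    using K_iff by (auto simp: A_def odds_def odd_pos)
  have inj: "inj_on ?sq A" by (auto intro: inj_onI)
  have "(\<Sum>m\<in>odds 0 M. ?h m) = (\<Sum>m\<in>odds 0 M - ?sq ` A. ?h m) + (\<Sum>k\<in>A. ?h (?sq k))"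
    using sum.subset_diff[OF sub, of ?h] inj by (simp add: sum.reindex)
  then have split: "(\<Sum>m\<in>odds 0 M. ?h m) - T * (\<Sum>k\<in>A. totient k / real k ^ 3)
      = (\<Sum>m\<in>odds 0 M - ?sq ` A. ?h m) + (\<Sum>k\<in>A. ?h (?sq k) - T * (totient k / real k ^ 3))"
    by (simp add: sum_subtractf sum_distrib_left)
  have "norm (\<Sum>m\<in>odds 0 M - ?sq ` A. ?h m)
      \<le> of_nat (card (odds 0 M - ?sq ` A)) * (8 * sqrt M * (1 + ln M))"
  proof (rule sum_norm_bound)
    fix m assume m: "m \<in> odds 0 M - ?sq ` A"
    then have m': "odd m" "0 < m" "m \<le> M" by (auto simp: odds_def)
    have nsq: "\<nexists>k. m = k\<^sup>2"
    proof
      assume "\<exists>k. m = k\<^sup>2"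
      then obtain k where "m = int (nat \<bar>k\<bar>) ^ 2" by auto
      then have "nat \<bar>k\<bar> \<in> A" using m' K_iff by (simp add: A_def)
      then show False using m \<open>m = int (nat \<bar>k\<bar>) ^ 2\<close> by blast
    qed
    have "norm (?h m) \<le> 8 * sqrt (of_int m) * (1 + ln (of_int m))"
      using hyperbola_sum_nonsquare[OF m'(1,2) nsq] by simp
    also have "\<dots> \<le> 8 * sqrt M * (1 + ln M)"
      using m' by (intro mult_mono) auto
    finally show "norm (?h m) \<le> 8 * sqrt M * (1 + ln M)" .
  qed
  also have "\<dots> \<le> of_int M * (8 * sqrt M * (1 + ln M))"
  proof (rule mult_right_mono)
    have "card (odds 0 M - ?sq ` A) \<le> card {0<..M}"
      by (intro card_mono) (auto simp: odds_def)
    then show "real (card (odds 0 M - ?sq ` A)) \<le> of_int M" using assms(1) by simp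
  qed (use assms(1) in simp)
  finally have 1: "\<bar>\<Sum>m\<in>odds 0 M - ?sq ` A. ?h m\<bar> \<le> of_int M * (8 * sqrt M * (1 + ln M))" by simp
  have "norm (\<Sum>k\<in>A. ?h (?sq k) - T * (totient k / real k ^ 3)) \<le> of_nat (card A) * (9 * of_int M)"
    using hyperbola_sum_square[OF _ _ assms(2)] K_iff by (intro sum_norm_bound) (auto simp: A_def)
  also have "\<dots> \<le> sqrt M * (9 * of_int M)"
  proof (rule mult_right_mono)
    \<comment> \<open>Oddness excludes 0, so there are at most \<open>K\<close> roots.\<close>
    have "card A \<le> card {1..K}" by (intro card_mono) (auto simp: A_def odd_pos Suc_le_eq)
    then have "real (card A) \<le> real K" by simp
    also have "\<dots> \<le> sqrt M" using assms(1) by (simp add: K_def)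
    finally show "real (card A) \<le> sqrt M" .
  qed (use assms(1) in simp)
  finally have 2: "\<bar>\<Sum>k\<in>A. ?h (?sq k) - T * (totient k / real k ^ 3)\<bar> \<le> sqrt M * (9 * of_int M)" by simp
  show ?thesis
    using 1 2 unfolding K_def[symmetric] A_def[symmetric] of_int_sum split by linarith
qed

theorem theorem1p5:
  shows "\<exists>C::real. \<forall>T::real. T \<ge> 2 \<longrightarrow>
    \<bar>(\<Sum>(n, m) \<in> {(n::int, m::int). 1 \<le> n \<and> real_of_int n \<le> T \<and> 1 \<le> m \<and> real_of_int m \<le> T \<and>
                              \<not> 2 dvd n * m \<and> real_of_int (n * m) \<le> T}.
        real_of_int (jacobi n m)) - 6 * zeta 2 / (7 * zeta 3) * T\<bar>
      \<le> C * (T powr (3/4) * ln T)"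
proof (intro exI[of _ 60] allI impI)
  fix T :: real assume T: "2 \<le> T"
  define R where "R = sqrt T"
  define M where "M = \<lfloor>R\<rfloor>"
  define K where "K = nat \<lfloor>sqrt M\<rfloor>"
  define D where "D = 6 * zeta 2 / (7 * zeta 3)"
  define S where "S = real_of_int (\<Sum>m\<in>odds 0 M. hyperbola_sum M \<lfloor>T\<rfloor> m)"
  define \<Phi> where "\<Phi> = (\<Sum>k | odd k \<and> k \<le> K. totient k / real k ^ 3)"
  have TR: "T = R\<^sup>2" "1 \<le> R" using T by (simp_all add: R_def)
  have M: "1 \<le> M" "of_int M \<le> R" "R < of_int M + 1" using TR by (simp_all add: M_def)
  have "(real_of_int M)\<^sup>2 \<le> T" unfolding TR using M by (intro power_mono) auto
  then have M1: "M\<^sup>2 \<le> \<lfloor>T\<rfloor>" by (simp add: le_floor_iff)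
  have "T < (real_of_int M + 1)\<^sup>2" unfolding TR using M TR by (intro power_strict_mono) auto
  then have M2: "\<lfloor>T\<rfloor> < (M + 1)\<^sup>2" by (simp add: floor_less_iff)
  let ?Q = "{(n::int, m::int). 1 \<le> n \<and> real_of_int n \<le> T \<and> 1 \<le> m \<and> real_of_int m \<le> T \<and>
                              \<not> 2 dvd n * m \<and> real_of_int (n * m) \<le> T}"
  \<comment> \<open>Both entries are at least 1, so the bound on the product implies the separate
    bounds; the floor makes the condition integral.\<close>
  have "1 \<le> n \<and> real_of_int n \<le> T \<and> 1 \<le> m \<and> real_of_int m \<le> T \<and>
        \<not> 2 dvd n * m \<and> real_of_int (n * m) \<le> T
      \<longleftrightarrow> 0 < n \<and> 0 < m \<and> odd n \<and> odd m \<and> n * m \<le> \<lfloor>T\<rfloor>" for n m :: int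
  proof (cases "0 < n \<and> 0 < m \<and> n * m \<le> \<lfloor>T\<rfloor>")
    case True
    then have "n * 1 \<le> n * m" "1 * m \<le> n * m" by (intro mult_mono; simp)+
    with True have "n \<le> \<lfloor>T\<rfloor>" "m \<le> \<lfloor>T\<rfloor>" by linarith+
    with True show ?thesis unfolding le_floor_iff[symmetric] by auto
  next
    case False
    then show ?thesis unfolding le_floor_iff[symmetric] by auto
  qed
  then have "?Q = {(n, m). 0 < n \<and> 0 < m \<and> odd n \<and> odd m \<and> n * m \<le> \<lfloor>T\<rfloor>}" by simp
  then have "(\<Sum>(n, m)\<in>?Q. real_of_int (jacobi n m)) = S"
    using sum_jacobi_hyperbola[OF _ M2] M by (simp add: S_def case_prod_unfold flip: of_int_sum)
  moreover have "\<bar>S - T * \<Phi>\<bar> \<le> of_int M * (8 * sqrt M * (1 + ln M)) + sqrt M * (9 * of_int M)"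
    unfolding S_def \<Phi>_def K_def by (rule sum_hyperbola_sum[OF M(1) M1])
  moreover have "of_int M * (8 * sqrt M * (1 + ln M)) + sqrt M * (9 * of_int M)
      \<le> R * (8 * sqrt R * (1 + ln R)) + sqrt R * (9 * R)"
    using M TR by (intro add_mono mult_mono) auto
  moreover have "\<bar>T * \<Phi> - D * T\<bar> \<le> 4 * (R * sqrt R)"
  proof -
    have K: "1 \<le> real K" "sqrt M < real K + 1"
    proof -
      have "1 \<le> \<lfloor>sqrt M\<rfloor>" using M by (simp add: le_floor_iff)
      then show "1 \<le> real K" by (simp add: K_def)
      show "sqrt M < real K + 1" using \<open>1 \<le> \<lfloor>sqrt M\<rfloor>\<close> by (simp add: K_def)
    qed
    \<comment> \<open>From \<open>R < M + 1 \<le> 2 * M\<close> follows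
      \<open>R / 4 \<le> M\<close>, and \<open>K \<ge> (K + 1) / 2 > sqrt M / 2\<close>. Hence
      \<open>K\<close> is at least \<open>sqrt R / 4\<close>, the origin of the constant 4 in the
      truncation error.\<close>
    have "sqrt R / 2 = sqrt (R / 4)" by (simp add: real_sqrt_divide)
    also have "\<dots> \<le> sqrt M" using M by (intro real_sqrt_le_mono) linarith
    finally have "sqrt R / 4 \<le> real K" using K by linarith
    have "\<bar>T * \<Phi> - D * T\<bar> = T * \<bar>D - \<Phi>\<bar>"
    proof -
      have "T * \<Phi> - D * T = - (T * (D - \<Phi>))" by (simp add: algebra_simps)
      then show ?thesis using T by (simp add: abs_mult)
    qed
    also have "\<dots> \<le> T * (1 / real K)"
      unfolding D_def \<Phi>_def using T K by (intro mult_left_mono totient_series_tail) auto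
    also have "\<dots> \<le> T * (1 / (sqrt R / 4))"
      using T TR \<open>sqrt R / 4 \<le> real K\<close> by (intro mult_left_mono frac_le) auto
    also have "\<dots> = 4 * (R * (R / sqrt R))" using TR by (simp add: power2_eq_square)
    also have "R / sqrt R = sqrt R" using TR by (simp add: real_div_sqrt)
    finally show ?thesis .
  qed
  ultimately have "\<bar>(\<Sum>(n, m)\<in>?Q. real_of_int (jacobi n m)) - D * T\<bar>
      \<le> R * (8 * sqrt R * (1 + ln R)) + sqrt R * (9 * R) + 4 * (R * sqrt R)" by linarith
  \<comment> \<open>Here 21 = 8 + 9 + 4: the nonsquare moduli without their logarithm, the square
    moduli, and the truncation.\<close>
  also have "\<dots> = R * sqrt R * (21 + 8 * ln R)" by (simp add: algebra_simps)
  also have "R * sqrt R = T powr (3/4)"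
  proof -
    have "R * sqrt R = T powr (1/2) * (T powr (1/2)) powr (1/2)"
      using T by (simp add: R_def powr_half_sqrt)
    then show ?thesis by (simp add: powr_powr flip: powr_add)
  qed
  also have "ln R = ln T / 2" using T by (simp add: R_def ln_sqrt)
  also have "T powr (3/4) * (21 + 8 * (ln T / 2)) \<le> T powr (3/4) * (60 * ln T)"
  proof (rule mult_left_mono)
    \<comment> \<open>The claim is \<open>21 \<le> 56 * ln T\<close>, and
      \<open>ln 2 \<ge> 2 / 3\<close> makes the right-hand side more than 37.\<close>
    have "ln 2 \<le> ln T" using T by simp
    then show "21 + 8 * (ln T / 2) \<le> 60 * ln T" using ln2_ge_two_thirds by linarith
  qed simp
  finally show "\<bar>(\<Sum>(n, m)\<in>?Q. real_of_int (jacobi n m)) - 6 * zeta 2 / (7 * zeta 3) * T\<bar>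
      \<le> 60 * (T powr (3/4) * ln T)"
    by (simp add: D_def mult_ac)
qed

end
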